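(* Let $d\ge 1$ and let $\mathbf X=(X_t)_{t\ge 0}$ be an isotropic Lévy process in $\mathbb R^d$ with Lévy–Khintchine exponent $\psi$. If $\psi\in\mathcal R^0_\alpha$ for some $\alpha\in[0,2)$, then $$\lim_{\substack{r\to0^+\\ t\psi(r)\to0}}\frac{\mathbb P(|X_t|\ge r^{-1})}{t\,\psi(r)}=\mathcal C_{d,\alpha},\qquad\text{where}\qquad \mathcal C_{d,\alpha}=2^\alpha\frac{\Gamma((d+\alpha)/2)}{\Gamma(d/2)\,\Gamma(1-\alpha/2)}.$$
   Context: An isotropic Lévy process in $\mathbb R^d$ is a Lévy process $\mathbf X=(X_t)_{t\ge0}$ with $X_0=0$ a.s. such that each $X_t$ has a rotationally invariant distribution $p(t,dx)$. Its Lévy–Khintchine exponent $\psi$ is defined by $\int_{\mathbb R^d}e^{i\langle\xi,x\rangle}p(t,dx)=e^{-t\psi(\xi)}$, with $\psi(\xi)=\int_{\mathbb R^d}(1-\cos\langle\xi,x\rangle)\,\nu(dx)+\eta|\xi|^2$, where $\eta\ge0$ and $\nu$ is a rotationally invariant Lévy measure. The function $\psi$ is radial and one writes $\psi(r)=\psi(\xi)$ for $r=|\xi|$. Regular variation: $f:[x_0,+\infty)\to(0,+\infty)$, $x_0>0$, is in $\mathcal R^\infty_\alpha$ (regularly varying of index $\alpha$ at infinity) if $f(\lambda x)/f(x)\to\lambda^\alpha$ as $x\to+\infty$ for each $\lambda>0$. A function $f$, positive near zero, is in $\mathcal R^0_\alpha$ (regularly varying of index $\alpha$ at zero) if $x\mapsto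 f(x^{-1})^{-1}$ is in $\mathcal R^\infty_\alpha$, i.e. $f(\lambda x)/f(x)\to\lambda^\alpha$ as $x\to0^+$ for each $\lambda>0$. The condition $\psi\in\mathcal R^0_\alpha$ refers to $r\mapsto\psi(r)$. The joint limit means: for every $\varepsilon>0$ there is $\delta>0$ such that the quotient is within $\varepsilon$ of the limit for all $t>0$ and all $r\in(0,\delta]$ with $t\psi(r)\le\delta$. *)

theory Defs
  imports "HOL-Probability.Probability"
begin

definition regularly_varying_at_infinity :: "real \<Rightarrow> (real \<Rightarrow> real) \<Rightarrow> bool" where
  "regularly_varying_at_infinity \<alpha> f \<longleftrightarrow>
     (\<exists>x\<^sub>0>0. \<forall>x\<ge>x\<^sub>0. f x > 0) \<and>
     (\<forall>c>0. ((\<lambda>x. f (c * x) / f x) \<longlongrightarrow> c powr \<alpha>) at_top)"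

definition regularly_varying_at_zero :: "real \<Rightarrow> (real \<Rightarrow> real) \<Rightarrow> bool" where
  "regularly_varying_at_zero \<alpha> f \<longleftrightarrow>
     regularly_varying_at_infinity \<alpha> (\<lambda>x. inverse (f (inverse x)))"

text \<open>
  Time is restricted to the half-line \<open>t \<ge> 0\<close>; values of \<open>X\<close> at negative times are irrelevant.
  Path regularity is only required in the form of stochastic continuity, which is
  implied by almost surely right-continuous paths with left limits.
\<close>

locale levy_process = prob_space M
  for M :: "'w measure" and X :: "real \<Rightarrow> 'w \<Rightarrow> real ^ 'n" +
  assumes measurable_X: "t \<ge> 0 \<Longrightarrow> random_variable borel (X t)"
    and starts_at_zero: "AE \<omega> in M. X 0 \<omega> = 0"
    and independent_increments:
      "0 \<le> \<tau> 0 \<Longrightarrow> mono \<tau> \<Longrightarrow>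
        indep_vars (\<lambda>_. borel) (\<lambda>i \<omega>. X (\<tau> (Suc i)) \<omega> - X (\<tau> i) \<omega>) {..<n::nat}"
    and stationary_increments:
      "0 \<le> s \<Longrightarrow> 0 \<le> t \<Longrightarrow>
        distr M borel (\<lambda>\<omega>. X (s + t) \<omega> - X s \<omega>) = distr M borel (X t)"
    and stochastically_continuous:
      "0 \<le> s \<Longrightarrow> 0 < \<epsilon> \<Longrightarrow>
        ((\<lambda>t. prob {\<omega> \<in> space M. norm (X t \<omega> - X s \<omega>) > \<epsilon>}) \<longlongrightarrow> 0) (at s within {0..})"

text \<open>
  Invariance is under the full orthogonal group, including reflections. In dimension one
  this is symmetry, whereas the special orthogonal group would be trivial.
\<close>

definition rotationally_invariant :: "(real ^ 'n) measure \<Rightarrow> bool" where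
  "rotationally_invariant \<mu> \<longleftrightarrow>
     sets \<mu> = sets borel \<and> (\<forall>T. orthogonal_transformation T \<longrightarrow> distr \<mu> borel T = \<mu>)"

locale isotropic_levy_process = levy_process M X
  for M :: "'w measure" and X :: "real \<Rightarrow> 'w \<Rightarrow> real ^ 'n" +
  assumes isotropic: "t \<ge> 0 \<Longrightarrow> rotationally_invariant (distr M borel (X t))"

definition levy_measure :: "(real ^ 'n) measure \<Rightarrow> bool" where
  "levy_measure \<nu> \<longleftrightarrow>
     sets \<nu> = sets borel \<and> emeasure \<nu> {0} = 0 \<and>
     (\<integral>\<^sup>+x. ennreal (min 1 ((norm x)\<^sup>2)) \<partial>\<nu>) < \<infinity>"

text \<open>
  The first conjunct determines \<open>\<psi>\<close> uniquely among real functions. By the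
  Levy--Khintchine theorem the second one is no further restriction for an isotropic
  Levy process; it records the form of the exponent.
\<close>

definition levy_khintchine_exponent ::
    "'w measure \<Rightarrow> (real \<Rightarrow> 'w \<Rightarrow> real ^ 'n) \<Rightarrow> (real ^ 'n \<Rightarrow> real) \<Rightarrow> bool" where
  "levy_khintchine_exponent M X \<psi> \<longleftrightarrow>
     (\<forall>t\<ge>0. \<forall>\<xi>. (CLINT x | distr M borel (X t). iexp (\<xi> \<bullet> x)) = exp (- complex_of_real (t * \<psi> \<xi>))) \<and>
     (\<exists>\<eta>\<ge>0. \<exists>\<nu>. levy_measure \<nu> \<and> rotationally_invariant \<nu> \<and>
        (\<forall>\<xi>. \<psi> \<xi> = (\<integral>x. (1 - cos (\<xi> \<bullet> x)) \<partial>\<nu>) + \<eta> * (norm \<xi>)\<^sup>2))"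

text \<open>
  The radial profile \<open>r \<mapsto> f(\<xi>)\<close>, \<open>|\<xi>| = r\<close>, of a radial function, evaluated along an
  arbitrary unit vector. The choice of the vector does not matter for an exponent of an isotropic
  process, as shown in the two lemmas that follow.
\<close>

definition radial_profile :: "(real ^ 'n \<Rightarrow> real) \<Rightarrow> real \<Rightarrow> real" where
  "radial_profile f r = f (r *\<^sub>R (SOME u. norm u = 1))"

lemma levy_khintchine_exponent_radial:
  fixes \<psi> :: "real ^ 'n \<Rightarrow> real"
  assumes "levy_khintchine_exponent M X \<psi>" "norm \<xi> = norm \<zeta>"
  shows "\<psi> \<xi> = \<psi> \<zeta>"
proof -
  obtain \<eta> \<nu> where \<nu>: "rotationally_invariant \<nu>"
    and \<psi>: "\<And>\<xi>. \<psi> \<xi> = (\<integral>x. (1 - cos (\<xi> \<bullet> x)) \<partial>\<nu>) + \<eta> * (norm \<xi>)\<^sup>2"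
    using assms(1) unfolding levy_khintchine_exponent_def by blast
  obtain T where T: "orthogonal_transformation T" and T\<zeta>: "T \<zeta> = \<xi>"
    using orthogonal_transformation_exists[of \<zeta> \<xi>] assms(2) by metis
  have sets_eq: "sets \<nu> = sets borel" and inv: "distr \<nu> borel T = \<nu>"
    using \<nu> T unfolding rotationally_invariant_def by auto
  have "continuous_on UNIV T"
    using T by (simp add: orthogonal_transformation_linear linear_continuous_on linear_linear)
  then have "T \<in> borel_measurable borel"
    by (rule borel_measurable_continuous_onI)
  then have meas: "T \<in> measurable \<nu> borel"
    by (simp add: measurable_cong_sets[OF sets_eq refl])
  have "(\<integral>x. (1 - cos (\<xi> \<bullet> x)) \<partial>\<nu>) = (\<integral>x. (1 - cos (\<xi> \<bullet> x)) \<partial>distr \<nu> borel T)"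
    by (simp add: inv)
  also have "\<dots> = (\<integral>x. (1 - cos (\<xi> \<bullet> T x)) \<partial>\<nu>)"
    by (rule integral_distr[OF meas]) measurable
  also have "\<dots> = (\<integral>x. (1 - cos (\<zeta> \<bullet> x)) \<partial>\<nu>)"
    using T by (simp add: T\<zeta>[symmetric] orthogonal_transformation_def)
  finally show ?thesis
    using assms(2) by (simp add: \<psi>)
qed

lemma levy_khintchine_exponent_radial_profile:
  fixes \<psi> :: "real ^ 'n \<Rightarrow> real"
  assumes "levy_khintchine_exponent M X \<psi>"
  shows "radial_profile \<psi> (norm \<xi>) = \<psi> \<xi>"
proof -
  have "norm (SOME u :: real ^ 'n. norm u = 1) = 1"
    by (rule someI_ex) (metis vector_choose_size zero_le_one)
  then show ?thesis
    unfolding radial_profile_def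
    by (intro levy_khintchine_exponent_radial[OF assms]) simp
qed

end

theory Submission
  imports Defs
begin

text \<open>
  The tail of \<open>norm (X t)\<close> is recovered from the Laplace transform of its square. If \<open>Z\<close> is a
  standard Gaussian vector in the same space, independent of the process, then
  \<open>E (exp (- s * (r * norm (X t))\<^sup>2)) = E (exp (- t * \<psi> (sqrt (2 * s) * r * norm Z)))\<close>,
  because the Gaussian function is its own Fourier transform
  (\<open>Laplace_levy_norm_square\<close>). As \<open>r\<close> and \<open>c = t * \<psi> r\<close> tend to zero,
  \<open>(1 - exp (- t * \<psi> (l * r))) / c\<close> tends to \<open>l powr \<alpha>\<close> for each \<open>l > 0\<close> by regular variation. So the
  Laplace exponents \<open>E (1 - exp (- s * (r * norm (X t))\<^sup>2)) / c\<close> tend to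
  \<open>(2 * s) powr (\<alpha> / 2) * E (norm Z powr \<alpha>)\<close>.

  For the passage to the limit under the expectation one needs \<open>\<psi> (l * r) \<le> C * max 1 (l\<^sup>2) * \<psi> r\<close> for all
  \<open>l \<ge> 0\<close> and small \<open>r\<close>. An exponent need not be monotone, and in dimension one it
  can even vanish away from the origin. The bound comes from \<open>\<psi> (x \<plusminus> y) \<le> 2 * (\<psi> x + \<psi> y)\<close> together with
  a measure-theoretic argument of Steinhaus type (\<open>eventually_quadratic_bound\<close>).

  On the other side, the Laplace exponent above is \<open>s\<close> times the Laplace transform of the tail function
  \<open>u \<mapsto> P (u \<le> (r * norm (X t))\<^sup>2) / c\<close> (\<open>Laplace_tail\<close>). The limit is \<open>s\<close> times the transform of
  \<open>A * u powr (- \<alpha> / 2)\<close> with \<open>A = 2 powr (\<alpha> / 2) * E (norm Z powr \<alpha>) / Gamma (1 - \<alpha> / 2)\<close>. Tail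
  functions are decreasing, so convergence of the transforms implies convergence at the point \<open>u = 1\<close>
  (\<open>tendsto_antimono_of_Laplace\<close>), which is the assertion with the constant \<open>A\<close>. Finally the Gaussian moment is
  \<open>2 powr (\<alpha> / 2) * Gamma ((d + \<alpha>) / 2) / Gamma (d / 2)\<close> (\<open>std_gaussian_norm_moment\<close>).
\<close>

section \<open>Laplace transforms of decreasing functions\<close>

lemma nn_integral_powr_exp:
  fixes p a :: real
  assumes "p > 0" "a > 0"
  shows "(\<integral>\<^sup>+t. ennreal (indicator {0<..} t * (t powr (p - 1) * exp (- (a * t)))) \<partial>lborel)
           = ennreal (Gamma p * a powr (- p))"
proof -
  have "(\<integral>\<^sup>+t. ennreal (indicator {0<..} t * (t powr (p - 1) * exp (- (a * t)))) \<partial>lborel)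
      = (\<integral>\<^sup>+t. ennreal (indicator {0<..} (0 + inverse a * t) *
            ((0 + inverse a * t) powr (p - 1) * exp (- (a * (0 + inverse a * t))))) \<partial>lborel) * ennreal \<bar>inverse a\<bar>"
    using assms by (subst nn_integral_real_affine[where c = "inverse a" and t = 0]) (auto simp: mult.commute)
  also have "(\<integral>\<^sup>+t. ennreal (indicator {0<..} (0 + inverse a * t) *
            ((0 + inverse a * t) powr (p - 1) * exp (- (a * (0 + inverse a * t))))) \<partial>lborel)
      = (\<integral>\<^sup>+t. ennreal (a powr (1 - p)) * ennreal (indicator {0..} t * t powr (p - 1) / exp t) \<partial>lborel)"
    using assms
    by (intro nn_integral_cong)
       (auto simp: indicator_def ennreal_mult[symmetric] powr_mult powr_minus powr_diff exp_minus
          field_simps inverse_powr zero_less_mult_iff powr_divide)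
  also have "\<dots> = ennreal (a powr (1 - p)) * ennreal (Gamma p)"
    using assms by (subst nn_integral_cmult) (simp_all add: Gamma_conv_nn_integral_real)
  finally show ?thesis
    using assms by (simp add: ennreal_mult[symmetric] powr_diff powr_minus field_simps Gamma_real_pos_exp
        Gamma_real_nonneg)
qed

text \<open>
  Karamata's device: on the range \<open>[0, 1]\<close> of \<open>e\<close> every continuous function is a uniform limit of
  polynomials, and the total masses of the measures with densities \<open>h n\<close> are bounded because
  they converge (the case \<open>k = 0\<close>). So convergence of all power moments carries over to continuous
  test functions.
\<close>

lemma tendsto_integral_continuous_of_powers:
  fixes e :: "'a \<Rightarrow> real" and g :: "real \<Rightarrow> real" and h :: "nat \<Rightarrow> 'a \<Rightarrow> real"
  assumes e: "e \<in> borel_measurable N" "\<And>x. x \<in> space N \<Longrightarrow> 0 \<le> e x \<and> e x \<le> 1"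
    and h: "\<And>n. integrable N (h n)" "\<And>n x. x \<in> space N \<Longrightarrow> 0 \<le> h n x"
    and h0: "integrable N h\<^sub>0" "\<And>x. x \<in> space N \<Longrightarrow> 0 \<le> h\<^sub>0 x"
    and lim: "\<And>k::nat. (\<lambda>n. \<integral>x. e x ^ k * h n x \<partial>N) \<longlonglongrightarrow> (\<integral>x. e x ^ k * h\<^sub>0 x \<partial>N)"
    and g: "continuous_on UNIV g"
  shows "(\<lambda>n. \<integral>x. g (e x) * h n x \<partial>N) \<longlonglongrightarrow> (\<integral>x. g (e x) * h\<^sub>0 x \<partial>N)"
proof (rule LIMSEQ_I)
  fix r :: real assume r: "r > 0"
  have [measurable]: "g \<in> borel_measurable borel"
    using g by (rule borel_measurable_continuous_onI)
  note [measurable] = e(1)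
  have int_bdd: "integrable N (\<lambda>x. f (e x) * w x)"
    if f: "continuous_on UNIV f" and w: "integrable N w" for f :: "real \<Rightarrow> real" and w
  proof -
    have [measurable]: "f \<in> borel_measurable borel"
      using f by (rule borel_measurable_continuous_onI)
    obtain B where "\<forall>x\<in>{0..1}. \<bar>f x\<bar> \<le> B"
      using compact_imp_bounded[OF compact_continuous_image[OF continuous_on_subset[OF f] compact_Icc[of 0 1]]]
      by (auto simp: bounded_iff)
    then have "\<bar>f (e x)\<bar> \<le> \<bar>B\<bar>" if "x \<in> space N" for x
      using e(2)[OF that] by (meson abs_ge_self atLeastAtMost_iff order_trans)
    then show ?thesis
      using w by (intro Bochner_Integration.integrable_bound[of N "\<lambda>x. B * w x" "\<lambda>x. f (e x) * w x"] AE_I2)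
        (auto simp: abs_mult intro!: mult_right_mono)
  qed
  define L where "L = (\<integral>x. h\<^sub>0 x \<partial>N)"
  have L: "L \<ge> 0" unfolding L_def using h0 by (intro integral_nonneg_AE AE_I2)
  have lim0: "(\<lambda>n. \<integral>x. h n x \<partial>N) \<longlonglongrightarrow> L"
    using lim[of 0] by (simp add: L_def)
  \<comment> \<open>The limit mass is \<open>L\<close> and the masses are eventually below \<open>L + 1\<close>, so an approximation
    within \<open>\<eta>\<close> costs at most \<open>r / 3\<close> on either side.\<close>
  define \<eta> where "\<eta> = r / (3 * (L + 1))"
  have \<eta>: "\<eta> > 0" using r L by (simp add: \<eta>_def)
  obtain p where p: "real_polynomial_function p" and gp: "\<And>x. x \<in> {0..1} \<Longrightarrow> \<bar>g x - p x\<bar> < \<eta>"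
    using Stone_Weierstrass_real_polynomial_function[OF compact_Icc continuous_on_subset[OF g subset_UNIV] \<eta>] by blast
  obtain a m where pa: "p = (\<lambda>x. \<Sum>i\<le>m. a i * x ^ i)"
    using p unfolding real_polynomial_function_iff_sum by blast
  have pc: "continuous_on UNIV p" unfolding pa by (intro continuous_intros)
  have pexp: "(\<integral>x. p (e x) * w x \<partial>N) = (\<Sum>i\<le>m. a i * (\<integral>x. e x ^ i * w x \<partial>N))"
    if w: "integrable N w" for w
  proof -
    have "integrable N (\<lambda>x. e x ^ i * w x)" for i
      by (rule int_bdd[OF _ w]) (intro continuous_intros)
    then show ?thesis
      by (simp add: pa sum_distrib_right mult.assoc)
  qed
  have plim: "(\<lambda>n. \<integral>x. p (e x) * h n x \<partial>N) \<longlonglongrightarrow> (\<integral>x. p (e x) * h\<^sub>0 x \<partial>N)"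
    unfolding pexp[OF h(1)] pexp[OF h0(1)] by (intro tendsto_intros lim)
  have close: "\<bar>(\<integral>x. g (e x) * w x \<partial>N) - (\<integral>x. p (e x) * w x \<partial>N)\<bar> \<le> \<eta> * (\<integral>x. w x \<partial>N)"
    if w: "integrable N w" "\<And>x. x \<in> space N \<Longrightarrow> 0 \<le> w x" for w
  proof -
    have "(\<integral>x. g (e x) * w x \<partial>N) - (\<integral>x. p (e x) * w x \<partial>N) = (\<integral>x. (g (e x) - p (e x)) * w x \<partial>N)"
      using int_bdd[OF g w(1)] int_bdd[OF pc w(1)] by (simp add: left_diff_distrib)
    also have "\<bar>\<dots>\<bar> \<le> (\<integral>x. \<bar>(g (e x) - p (e x)) * w x\<bar> \<partial>N)"
      using integral_norm_bound[of N "\<lambda>x. (g (e x) - p (e x)) * w x"] by simp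
    also have "\<dots> \<le> (\<integral>x. \<eta> * w x \<partial>N)"
    proof (rule integral_mono)
      show "integrable N (\<lambda>x. \<bar>(g (e x) - p (e x)) * w x\<bar>)"
        using int_bdd[OF continuous_on_diff[OF g pc] w(1)] by (rule integrable_abs)
      show "\<bar>(g (e x) - p (e x)) * w x\<bar> \<le> \<eta> * w x" if "x \<in> space N" for x
        using gp[of "e x"] e(2)[OF that] w(2)[OF that] by (auto simp: abs_mult intro!: mult_right_mono)
    qed (use w in auto)
    finally show ?thesis by simp
  qed
  have "\<forall>\<^sub>F n in sequentially. (\<integral>x. h n x \<partial>N) < L + 1"
    using order_tendstoD(2)[OF lim0, of "L + 1"] by simp
  moreover have "\<forall>\<^sub>F n in sequentially. \<bar>(\<integral>x. p (e x) * h n x \<partial>N) - (\<integral>x. p (e x) * h\<^sub>0 x \<partial>N)\<bar> < r / 3"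
    using tendstoD[OF plim, of "r / 3"] r by (simp add: dist_real_def)
  ultimately have "\<forall>\<^sub>F n in sequentially. norm ((\<integral>x. g (e x) * h n x \<partial>N) - (\<integral>x. g (e x) * h\<^sub>0 x \<partial>N)) < r"
  proof eventually_elim
    case (elim n)
    have \<eta>L: "\<eta> * (L + 1) = r / 3" using L by (simp add: \<eta>_def field_simps)
    have "\<eta> * (\<integral>x. h n x \<partial>N) \<le> \<eta> * (L + 1)" "\<eta> * L \<le> \<eta> * (L + 1)"
      using elim(1) \<eta> by (intro mult_left_mono; simp)+
    then show ?case
      using close[OF h(1) h(2), of n] close[OF h0] elim(2) \<eta>L unfolding L_def[symmetric] real_norm_def
      by linarith
  qed
  then show "\<exists>no. \<forall>n\<ge>no. norm ((\<integral>x. g (e x) * h n x \<partial>N) - (\<integral>x. g (e x) * h\<^sub>0 x \<partial>N)) < r"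
    by (simp add: eventually_sequentially)
qed

text \<open>
  A continuity theorem for Laplace transforms. With \<open>v = exp (- u)\<close>, the transforms at the positive
  integers are the power moments of the densities \<open>exp (- u) * F n u\<close>, so integrals against continuous
  functions of \<open>v\<close> converge. Averages of \<open>F n\<close> over short intervals next to \<open>x\<close> therefore converge, and
  monotonicity squeezes the value at \<open>x\<close> between the averages on its right and on its left.
\<close>

lemma tendsto_antimono_of_Laplace:
  fixes F :: "nat \<Rightarrow> real \<Rightarrow> real" and G :: "real \<Rightarrow> real"
  assumes F: "\<And>n x. 0 < x \<Longrightarrow> 0 \<le> F n x" "\<And>n x y. 0 < x \<Longrightarrow> x \<le> y \<Longrightarrow> F n y \<le> F n x"
      "\<And>n. set_integrable lborel {0<..} (\<lambda>u. exp (- u) * F n u)"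
    and G: "\<And>x. 0 < x \<Longrightarrow> 0 \<le> G x" "\<And>x y. 0 < x \<Longrightarrow> x \<le> y \<Longrightarrow> G y \<le> G x"
      "set_integrable lborel {0<..} (\<lambda>u. exp (- u) * G u)"
    and lim: "\<And>k. 1 \<le> k \<Longrightarrow> (\<lambda>n. LBINT u:{0<..}. exp (- (real k * u)) * F n u)
                \<longlonglongrightarrow> (LBINT u:{0<..}. exp (- (real k * u)) * G u)"
    and x: "0 < x" "isCont G x"
  shows "(\<lambda>n. F n x) \<longlonglongrightarrow> G x"
proof -
  define N where "N = restrict_space lborel {0::real<..}"
  have space_N [simp]: "space N = {0<..}" by (simp add: N_def space_restrict_space)
  have N_int: "integrable N f \<longleftrightarrow> set_integrable lborel {0<..} f"
    "(\<integral>u. f u \<partial>N) = (LBINT u:{0<..}. f u)" for f :: "real \<Rightarrow> real"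
    by (simp_all add: N_def integrable_restrict_space integral_restrict_space
        set_integrable_def set_lebesgue_integral_def)
  have exp_meas: "(\<lambda>u. exp (- u)) \<in> borel_measurable N"
    unfolding N_def by (rule measurable_restrict_space1) measurable
  have exp_int: "integrable N (\<lambda>u. exp (- u))"
  proof -
    have "integrable lborel (\<lambda>t::real. indicator {0<..} t * (t powr (1 - 1) * exp (- (1 * t))))"
      using nn_integral_powr_exp[of 1 1] by (intro integrableI_nn_integral_finite[where x="1"]) auto
    then show ?thesis unfolding N_int set_integrable_def
      by (rule back_subst[of "integrable lborel"]) (auto simp: fun_eq_iff indicator_def)
  qed
  \<comment> \<open>In the variable \<open>v = exp (- u)\<close> this is a continuous bump; in \<open>u\<close> it lives exactly on \<open>(a, b)\<close>.\<close>
  define tent where "tent a b v = max 0 (min (v - exp (- b)) (exp (- a) - v))" for a b v :: real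
  have tent_cont: "continuous_on UNIV (tent a b)" for a b
    unfolding tent_def by (intro continuous_intros)
  define avg where "avg H a b = (\<integral>u. tent a b (exp (- u)) * (exp (- u) * H u) \<partial>N)" for H :: "real \<Rightarrow> real" and a b
  define W where "W = avg (\<lambda>_. 1)"
  have tent_bound: "0 \<le> tent a b v" "v \<ge> 0 \<Longrightarrow> tent a b v \<le> exp (- a)" for a b v
    unfolding tent_def by auto
  have tent_supp: "a < u \<and> u < b" if "tent a b (exp (- u)) \<noteq> 0" for a b u
  proof -
    have "min (exp (-u) - exp (- b)) (exp (- a) - exp (-u)) > 0"
      using that unfolding tent_def by linarith
    then show ?thesis by simp
  qed
  have tent_meas: "(\<lambda>u. tent a b (exp (- u))) \<in> borel_measurable N" for a b
    using measurable_compose[OF exp_meas borel_measurable_continuous_onI[OF tent_cont]] .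
  have avg_int: "integrable N (\<lambda>u. tent a b (exp (- u)) * (exp (- u) * H u))"
    if "integrable N (\<lambda>u. exp (- u) * H u)" for H a b
  proof (rule Bochner_Integration.integrable_bound[of N "\<lambda>u. exp (- a) * (exp (- u) * H u)"])
    show "AE u in N. norm (tent a b (exp (- u)) * (exp (- u) * H u)) \<le> norm (exp (- a) * (exp (- u) * H u))"
      using tent_bound(1)[of a b] tent_bound(2)[of "exp (- _)" a b] by (auto simp: abs_mult intro!: mult_right_mono)
  qed (use that tent_meas[of a b] in auto)
  have W_pos: "W a b > 0" if "0 < a" "a < b" for a b
  proof -
    have I: "integrable N (\<lambda>u. tent a b (exp (- u)) * (exp (- u) * 1))"
      by (rule avg_int) (use exp_int in simp)
    have "W a b \<ge> 0"
      unfolding W_def avg_def using tent_bound by (intro integral_nonneg_AE AE_I2) simp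
    moreover have "W a b \<noteq> 0"
    proof
      assume "W a b = 0"
      then have "AE u in N. tent a b (exp (- u)) * (exp (- u) * 1) = 0"
        unfolding W_def avg_def
        using integral_nonneg_eq_0_iff_AE[OF I] tent_bound by simp
      then have "AE u in lborel. u \<in> {0<..} \<longrightarrow> tent a b (exp (- u)) = 0"
        unfolding N_def by (subst (asm) AE_restrict_space_iff) auto
      then have "AE u in lborel. u \<notin> {a<..<b}"
        by eventually_elim (use that in \<open>auto simp: tent_def min_def split: if_splits\<close>)
      then have "emeasure lborel {a<..<b} = 0"
        by (subst (asm) AE_iff_measurable[of "{a<..<b}"]) auto
      then show False using that by simp
    qed
    ultimately show ?thesis by simp
  qed
  have avg_bounds: "H b * W a b \<le> avg H a b" "avg H a b \<le> H a * W a b"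
    if ab: "0 < a" "a < b" and H: "\<And>x y. 0 < x \<Longrightarrow> x \<le> y \<Longrightarrow> H y \<le> H x"
      and HI: "integrable N (\<lambda>u. exp (- u) * H u)" for H a b
  proof -
    have 1: "integrable N (\<lambda>u. tent a b (exp (- u)) * (exp (- u) * 1))"
      by (rule avg_int) (use exp_int in simp)
    have W: "c * W a b = (\<integral>u. c * (tent a b (exp (- u)) * (exp (- u) * 1)) \<partial>N)" for c
      unfolding W_def avg_def by simp
    have pw: "H b * (tent a b (exp (- u)) * (exp (- u) * 1)) \<le> tent a b (exp (- u)) * (exp (- u) * H u)
      \<and> tent a b (exp (- u)) * (exp (- u) * H u) \<le> H a * (tent a b (exp (- u)) * (exp (- u) * 1))" for u
    proof (cases "tent a b (exp (- u)) = 0")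
      case False
      then have "H b \<le> H u" "H u \<le> H a"
        using tent_supp[OF False] ab H by auto
      then show ?thesis
        using mult_right_mono[of _ _ "tent a b (exp (- u)) * exp (- u)"] tent_bound(1)[of a b "exp (-u)"]
        by (simp add: mult_ac)
    qed simp
    show "H b * W a b \<le> avg H a b"
      unfolding W avg_def using pw
      by (intro integral_mono integrable_mult_right 1 avg_int[OF HI]; blast)
    show "avg H a b \<le> H a * W a b"
      unfolding W avg_def using pw
      by (intro integral_mono integrable_mult_right 1 avg_int[OF HI]; blast)
  qed
  have FI: "integrable N (\<lambda>u. exp (- u) * F n u)" for n
    using F(3) by (simp add: N_int)
  have GI: "integrable N (\<lambda>u. exp (- u) * G u)"
    using G(3) by (simp add: N_int)
  have avg_lim: "(\<lambda>n. avg (F n) a b) \<longlonglongrightarrow> avg G a b" for a b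
    unfolding avg_def
  proof (rule tendsto_integral_continuous_of_powers[OF exp_meas _ FI _ GI])
    show "(\<lambda>n. \<integral>u. exp (- u) ^ k * (exp (- u) * F n u) \<partial>N)
            \<longlonglongrightarrow> (\<integral>u. exp (- u) ^ k * (exp (- u) * G u) \<partial>N)" for k
    proof -
      have "exp (- u) ^ k * (exp (- u) * H u) = exp (- (real (Suc k) * u)) * H u" for u and H :: "real \<Rightarrow> real"
        by (simp add: exp_of_nat_mult[symmetric] exp_add[symmetric] algebra_simps)
      then show ?thesis using lim[of "Suc k"] by (simp only: N_int)
    qed
  qed (use F(1) G(1) tent_cont in auto)
  show ?thesis
  proof (rule order_tendstoI)
    fix c assume c: "c < G x"
    have "\<forall>\<^sub>F y in at x. c < G y"
      using order_tendstoD(1)[OF x(2)[unfolded isCont_def] c] .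
    then obtain d where d: "d > 0" "\<And>y. y \<noteq> x \<Longrightarrow> dist y x < d \<Longrightarrow> c < G y"
      unfolding eventually_at by auto
    define y where "y = x + d / 2"
    have y: "x < y" "c < G y" using d by (auto simp: y_def dist_real_def)
    have "c * W x y < avg G x y"
      using avg_bounds(1)[OF x(1) y(1) G(2) GI] mult_strict_right_mono[OF y(2) W_pos[OF x(1) y(1)]] by simp
    then have "\<forall>\<^sub>F n in sequentially. c * W x y < avg (F n) x y"
      by (rule order_tendstoD(1)[OF avg_lim])
    then show "\<forall>\<^sub>F n in sequentially. c < F n x"
    proof eventually_elim
      case (elim n)
      then have "c * W x y < F n x * W x y"
        using avg_bounds(2)[OF x(1) y(1) F(2) FI, of n] by simp
      then show ?case using W_pos[OF x(1) y(1)] by simp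
    qed
  next
    fix c assume c: "G x < c"
    have "\<forall>\<^sub>F y in at x. G y < c"
      using order_tendstoD(2)[OF x(2)[unfolded isCont_def] c] .
    then obtain d where d: "d > 0" "\<And>y. y \<noteq> x \<Longrightarrow> dist y x < d \<Longrightarrow> G y < c"
      unfolding eventually_at by auto
    define y where "y = x - min x d / 2"
    have y: "0 < y" "y < x" "G y < c" using d x(1) by (auto simp: y_def dist_real_def)
    have "avg G y x < c * W y x"
      using avg_bounds(2)[OF y(1,2) G(2) GI] mult_strict_right_mono[OF y(3) W_pos[OF y(1,2)]] by simp
    then have "\<forall>\<^sub>F n in sequentially. avg (F n) y x < c * W y x"
      by (rule order_tendstoD(2)[OF avg_lim])
    then show "\<forall>\<^sub>F n in sequentially. F n x < c"
    proof eventually_elim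
      case (elim n)
      then have "F n x * W y x < c * W y x"
        using avg_bounds(1)[OF y(1,2) F(2) FI, of n] by simp
      then show ?case using W_pos[OF y(1,2)] by simp
    qed
  qed
qed

section \<open>Tails and fractional moments from Laplace transforms\<close>

context prob_space begin

text \<open>
  Integrating the Laplace kernel against the tail of \<open>V\<close> trades the tail for an expectation: by Fubini
  the event \<open>u \<le> V x\<close> restricts the integral of \<open>exp (- (s * u))\<close> to \<open>(0, V x]\<close>.
\<close>

lemma Laplace_tail:
  fixes V :: "'a \<Rightarrow> real"
  assumes [measurable]: "V \<in> borel_measurable M" and V: "\<And>x. x \<in> space M \<Longrightarrow> 0 \<le> V x" and s: "0 < s"
  shows "set_integrable lborel {0<..} (\<lambda>u. exp (- (s * u)) * prob {x \<in> space M. u \<le> V x})"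
    and "(LBINT u:{0<..}. exp (- (s * u)) * prob {x \<in> space M. u \<le> V x})
           = expectation (\<lambda>x. 1 - exp (- (s * V x))) / s"
proof -
  let ?f = "\<lambda>u. indicator {0<..} u * (exp (- (s * u)) * prob {x \<in> space M. u \<le> V x})"
  interpret pair_sigma_finite lborel M ..
  have m: "(\<lambda>u. prob {x \<in> space M. u \<le> V x}) \<in> borel_measurable lborel"
    by measurable
  have int_exp: "integrable M (\<lambda>x. 1 - exp (- (s * V x)))"
    by (rule integrable_const_bound[of _ 1]) (use V s in auto)
  have inner: "(\<integral>\<^sup>+u. ennreal (indicator {0<..} u * exp (- (s * u))) * indicator {x \<in> space M. u \<le> V x} x \<partial>lborel)
      = ennreal ((1 - exp (- (s * V x))) / s)" if x: "x \<in> space M" for x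
  proof -
    have "(\<integral>\<^sup>+u. ennreal (indicator {0<..} u * exp (- (s * u))) * indicator {x \<in> space M. u \<le> V x} x \<partial>lborel)
      = (\<integral>\<^sup>+u. ennreal (exp (- (s * u))) * indicator {0..V x} u \<partial>lborel)"
    proof (rule nn_integral_cong_AE)
      show "AE u in lborel. ennreal (indicator {0<..} u * exp (- (s * u))) * indicator {x \<in> space M. u \<le> V x} x
          = ennreal (exp (- (s * u))) * indicator {0..V x} u"
        using AE_lborel_singleton[of "0::real"] by eventually_elim (use x in \<open>simp add: indicator_def\<close>)
    qed
    also have "\<dots> = ennreal (- exp (- (s * V x)) / s - - exp (- (s * 0)) / s)"
      by (rule nn_integral_FTC_Icc) (use s V[OF x] in \<open>auto intro!: derivative_eq_intros simp: has_real_derivative_iff_has_vector_derivative[symmetric]\<close>)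
    finally show ?thesis by (simp add: diff_divide_distrib)
  qed
  have "(\<integral>\<^sup>+u. ennreal (?f u) \<partial>lborel) = (\<integral>\<^sup>+u. \<integral>\<^sup>+x. ennreal (indicator {0<..} u * exp (- (s * u))) * indicator {x \<in> space M. u \<le> V x} x \<partial>M \<partial>lborel)"
    by (intro nn_integral_cong) (simp add: nn_integral_cmult emeasure_eq_measure ennreal_mult mult.assoc)
  also have "\<dots> = (\<integral>\<^sup>+x. \<integral>\<^sup>+u. ennreal (indicator {0<..} u * exp (- (s * u))) * indicator {x \<in> space M. u \<le> V x} x \<partial>lborel \<partial>M)"
    by (rule Fubini'[symmetric]) measurable
  also have "\<dots> = (\<integral>\<^sup>+x. ennreal ((1 - exp (- (s * V x))) / s) \<partial>M)"
    using inner by (rule nn_integral_cong)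
  also have "\<dots> = ennreal (expectation (\<lambda>x. (1 - exp (- (s * V x))) / s))"
    using int_exp V s by (intro nn_integral_eq_integral) auto
  finally have nn: "(\<integral>\<^sup>+u. ennreal (?f u) \<partial>lborel) = ennreal (expectation (\<lambda>x. 1 - exp (- (s * V x))) / s)"
    by simp
  have E0: "0 \<le> expectation (\<lambda>x. 1 - exp (- (s * V x)))"
    using V s by (intro integral_nonneg_AE AE_I2) auto
  have "has_bochner_integral lborel ?f (expectation (\<lambda>x. 1 - exp (- (s * V x))) / s)"
    using nn E0 s m by (intro has_bochner_integral_nn_integral) auto
  then show "set_integrable lborel {0<..} (\<lambda>u. exp (- (s * u)) * prob {x \<in> space M. u \<le> V x})"
    "(LBINT u:{0<..}. exp (- (s * u)) * prob {x \<in> space M. u \<le> V x})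
           = expectation (\<lambda>x. 1 - exp (- (s * V x))) / s"
    unfolding set_integrable_def set_lebesgue_integral_def
    by (auto simp: has_bochner_integral_iff)
qed

end

text \<open>
  For \<open>0 < b < 1\<close> the substitution \<open>s \<mapsto> s / u\<close> shows that the integral of
  \<open>(1 - exp (- (s * u))) * s powr (- b - 1)\<close> over \<open>s > 0\<close> is a multiple of \<open>u powr b\<close>. The
  factor is positive and finite, so it can be cancelled when two such integrals are compared.
\<close>

lemma nn_integral_Laplace_kernel_powr:
  fixes b :: real
  assumes "0 < b" "b < 1"
  defines "c \<equiv> \<integral>\<^sup>+s. ennreal (indicator {0<..} s * ((1 - exp (- s)) * s powr (- b - 1))) \<partial>lborel"
  shows "0 < c" "c < \<infinity>"
    and "\<And>u. 0 \<le> u \<Longrightarrow> (\<integral>\<^sup>+s. ennreal (indicator {0<..} s * ((1 - exp (- (s * u))) * s powr (- b - 1))) \<partial>lborel)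
            = c * ennreal (u powr b)"
proof -
  have "c \<noteq> 0"
  proof
    assume "c = 0"
    then have "AE s in lborel. indicator {0<..} s * ((1 - exp (- s)) * s powr (- b - 1)) \<le> 0"
      unfolding c_def by (subst (asm) nn_integral_0_iff_AE) (auto simp: ennreal_eq_0_iff)
    then have "AE s::real in lborel. s \<notin> {0<..<1}"
      by eventually_elim (auto simp: mult_le_0_iff not_le)
    then have "emeasure lborel {0<..<1::real} = 0"
      by (subst (asm) AE_iff_measurable[of "{0<..<1}"]) auto
    then show False by simp
  qed
  then show "0 < c" by (simp add: zero_less_iff_neq_zero)
  have "c \<le> (\<integral>\<^sup>+s. ennreal (s powr (- b)) * indicator {0..1} s + ennreal (s powr (- b - 1)) * indicator {1..} s \<partial>lborel)"
    unfolding c_def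
  proof (rule nn_integral_mono)
    fix s :: real
    \<comment> \<open>The two bounds are integrable near zero, as \<open>b < 1\<close>, and near infinity, as \<open>b > 0\<close>.\<close>
    have "(1 - exp (- s)) * s powr (- b - 1) \<le> s powr (- b)" if "0 < s"
    proof -
      have "(1 - exp (- s)) * s powr (- b - 1) \<le> s * s powr (- b - 1)"
        using exp_ge_add_one_self[of "- s"] by (intro mult_right_mono) auto
      also have "\<dots> = s powr (- b)"
        using that powr_mult_base[of s "- b - 1"] by simp
      finally show ?thesis .
    qed
    moreover have "(1 - exp (- s)) * s powr (- b - 1) \<le> s powr (- b - 1)" if "0 < s"
      using that by (intro mult_left_le_one_le) auto
    ultimately show "ennreal (indicator {0<..} s * ((1 - exp (- s)) * s powr (- b - 1)))
      \<le> ennreal (s powr (- b)) * indicator {0..1} s + ennreal (s powr (- b - 1)) * indicator {1..} s"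
      by (cases "s \<le> 0"; cases "s < 1"; cases "s = 1")
         (auto intro: ennreal_leI order_trans[OF ennreal_leI[of _ 1]] simp: indicator_def)
  qed
  also have "\<dots> = (\<integral>\<^sup>+s. ennreal (s powr (- b)) * indicator {0..1} s \<partial>lborel) + (\<integral>\<^sup>+s. ennreal (s powr (- b - 1)) * indicator {1..} s \<partial>lborel)"
    by (rule nn_integral_add) auto
  also have "(\<integral>\<^sup>+s. ennreal (s powr (- b)) * indicator {0..1} s \<partial>lborel) = ennreal (1 powr (- b + 1) / (- b + 1))"
    using nn_integral_has_integral_lebesgue[OF _ has_integral_powr_from_0[of "- b" 1]] assms
    by (simp add: ennreal_mult'' mult.commute ennreal_indicator)
  also have "(\<integral>\<^sup>+s. ennreal (s powr (- b - 1)) * indicator {1..} s \<partial>lborel) = ennreal (- (1 powr (- b - 1 + 1)) / (- b - 1 + 1))"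
    using nn_integral_has_integral_lebesgue[OF _ has_integral_powr_to_inf[of "- b - 1" 1]] assms
    by (simp add: ennreal_mult'' mult.commute ennreal_indicator)
  finally show "c < \<infinity>" by (auto simp: less_top[symmetric] top_unique)
  fix u :: real assume u: "0 \<le> u"
  show "(\<integral>\<^sup>+s. ennreal (indicator {0<..} s * ((1 - exp (- (s * u))) * s powr (- b - 1))) \<partial>lborel)
            = c * ennreal (u powr b)"
  proof (cases "u = 0")
    case False
    then have u: "u > 0" using u by simp
    have "(\<integral>\<^sup>+s. ennreal (indicator {0<..} s * ((1 - exp (- (s * u))) * s powr (- b - 1))) \<partial>lborel)
      = (\<integral>\<^sup>+s. ennreal (indicator {0<..} (0 + inverse u * s) * ((1 - exp (- ((0 + inverse u * s) * u))) * (0 + inverse u * s) powr (- b - 1))) \<partial>lborel) * ennreal \<bar>inverse u\<bar>"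
      using u by (subst nn_integral_real_affine[where c = "inverse u" and t = 0]) (auto simp: mult.commute)
    also have "(\<integral>\<^sup>+s. ennreal (indicator {0<..} (0 + inverse u * s) * ((1 - exp (- ((0 + inverse u * s) * u))) * (0 + inverse u * s) powr (- b - 1))) \<partial>lborel)
      = (\<integral>\<^sup>+s. ennreal (u powr (b + 1)) * ennreal (indicator {0<..} s * ((1 - exp (- s)) * s powr (- b - 1))) \<partial>lborel)"
      using u by (intro nn_integral_cong)
       (auto simp: indicator_def ennreal_mult[symmetric] powr_mult powr_minus powr_diff powr_add exp_minus
          field_simps inverse_powr zero_less_mult_iff powr_divide)
    also have "\<dots> = ennreal (u powr (b + 1)) * c"
      unfolding c_def by (rule nn_integral_cmult) auto
    finally have *: "(\<integral>\<^sup>+s. ennreal (indicator {0<..} s * ((1 - exp (- (s * u))) * s powr (- b - 1))) \<partial>lborel)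
      = ennreal (u powr (b + 1)) * c * ennreal \<bar>inverse u\<bar>" .
    show ?thesis
    proof -
      have "ennreal (u powr (b + 1)) * ennreal \<bar>inverse u\<bar> = ennreal (u powr b)"
        using u by (simp add: powr_add flip: ennreal_mult)
      with * show ?thesis by (metis mult.assoc mult.commute)
    qed
  qed simp
qed

text \<open>
  Fractional moments can be read off from the Laplace transform: integrate the representation of
  \<open>u powr b\<close> from the previous lemma over the distribution, exchange the integrals, and cancel the
  common factor.
\<close>

lemma nn_integral_powr_eq_of_Laplace:
  fixes U :: "'a \<Rightarrow> real" and V :: "'b \<Rightarrow> real"
  assumes "prob_space M" "prob_space N"
    and U [measurable]: "U \<in> borel_measurable M" and V [measurable]: "V \<in> borel_measurable N"
    and U0: "AE x in M. 0 \<le> U x" and V0: "AE x in N. 0 \<le> V x"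
    and eq: "\<And>s. 0 < s \<Longrightarrow> (\<integral>x. exp (- (s * U x)) \<partial>M) = (\<integral>x. exp (- (s * V x)) \<partial>N)"
    and b: "0 < b" "b < 1"
  shows "(\<integral>\<^sup>+x. ennreal (U x powr b) \<partial>M) = (\<integral>\<^sup>+x. ennreal (V x powr b) \<partial>N)"
proof -
  define c where "c = (\<integral>\<^sup>+s. ennreal (indicator {0<..} s * ((1 - exp (- s)) * s powr (- b - 1))) \<partial>lborel)"
  note c = nn_integral_Laplace_kernel_powr[OF b, folded c_def]
  have mom: "c * (\<integral>\<^sup>+x. ennreal (Y x powr b) \<partial>P)
      = (\<integral>\<^sup>+s. ennreal (indicator {0<..} s * s powr (- b - 1) * (1 - (\<integral>x. exp (- (s * Y x)) \<partial>P))) \<partial>lborel)"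
    if P: "prob_space P" and [measurable]: "Y \<in> borel_measurable P" and Y: "AE x in P. 0 \<le> Y x"
    for P and Y :: "'c \<Rightarrow> real"
  proof -
    interpret P: prob_space P by fact
    interpret pair_sigma_finite lborel P ..
    have "c * (\<integral>\<^sup>+x. ennreal (Y x powr b) \<partial>P) = (\<integral>\<^sup>+x. c * ennreal (Y x powr b) \<partial>P)"
      by (rule nn_integral_cmult[symmetric]) measurable
    also have "\<dots> = (\<integral>\<^sup>+x. \<integral>\<^sup>+s. ennreal (indicator {0<..} s * ((1 - exp (- (s * Y x))) * s powr (- b - 1))) \<partial>lborel \<partial>P)"
      by (rule nn_integral_cong_AE) (use Y in eventually_elim, simp add: c(3))
    also have "\<dots> = (\<integral>\<^sup>+s. \<integral>\<^sup>+x. ennreal (indicator {0<..} s * ((1 - exp (- (s * Y x))) * s powr (- b - 1))) \<partial>P \<partial>lborel)"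
      by (rule Fubini') measurable
    also have "\<dots> = (\<integral>\<^sup>+s. ennreal (indicator {0<..} s * s powr (- b - 1) * (1 - (\<integral>x. exp (- (s * Y x)) \<partial>P))) \<partial>lborel)"
    proof (rule nn_integral_cong)
      fix s :: real
      show "(\<integral>\<^sup>+x. ennreal (indicator {0<..} s * ((1 - exp (- (s * Y x))) * s powr (- b - 1))) \<partial>P)
        = ennreal (indicator {0<..} s * s powr (- b - 1) * (1 - (\<integral>x. exp (- (s * Y x)) \<partial>P)))"
      proof (cases "s > 0")
        case True
        have "integrable P (\<lambda>x. exp (- (s * Y x)))"
          by (rule P.integrable_const_bound[of _ 1]) (use Y True in \<open>auto elim!: eventually_mono\<close>)
        then have "has_bochner_integral P (\<lambda>x. (1 - exp (- (s * Y x))) * s powr (- b - 1)) ((1 - (\<integral>x. exp (- (s * Y x)) \<partial>P)) * s powr (- b - 1))"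
          by (auto simp: has_bochner_integral_iff P.prob_space)
        moreover have "AE x in P. 0 \<le> (1 - exp (- (s * Y x))) * s powr (- b - 1)"
          using Y by eventually_elim (use True in auto)
        ultimately show ?thesis
          using True by (simp add: has_bochner_integral_iff nn_integral_eq_integral mult.commute)
      qed simp
    qed
    finally show ?thesis .
  qed
  have "c * (\<integral>\<^sup>+x. ennreal (U x powr b) \<partial>M) = c * (\<integral>\<^sup>+x. ennreal (V x powr b) \<partial>N)"
    unfolding mom[OF assms(1) U U0] mom[OF assms(2) V V0]
    by (intro nn_integral_cong) (auto simp: indicator_def eq)
  then show ?thesis
    using c(1,2) unfolding ennreal_mult_cancel_left infinity_ennreal_def by (metis less_irrefl)
qed

section \<open>The standard Gaussian measure\<close>

text \<open>
  The standard Gaussian is transported from a product of one-dimensional ones, so that the integral of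
  a product over the coordinates factorizes.
\<close>

definition std_gaussian :: "(real ^ 'n) measure" where
  "std_gaussian = distr (Pi\<^sub>M UNIV (\<lambda>_. std_normal_distribution)) borel (\<lambda>f. \<chi> i. f i)"

interpretation std_normal: prob_space std_normal_distribution
  by (rule prob_space_normal_density) simp

interpretation std_normals: product_prob_space "\<lambda>_ :: 'n::finite. std_normal_distribution" UNIV
  by unfold_locales

lemma measurable_vec_lambda_PiM [measurable]:
  "(\<lambda>f. \<chi> i::'n::finite. f i) \<in> borel_measurable (Pi\<^sub>M UNIV (\<lambda>_. std_normal_distribution))"
proof (subst borel_measurable_euclidean_space, safe)
  fix b :: "real ^ 'n" assume "b \<in> Basis"
  then obtain i where "b = axis i 1" by (auto simp: Basis_vec_def)
  then show "(\<lambda>f. (\<chi> i. f i) \<bullet> b) \<in> borel_measurable (Pi\<^sub>M UNIV (\<lambda>_. std_normal_distribution))"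
    by (simp add: inner_axis)
qed

lemma sets_std_gaussian [simp, measurable_cong]: "sets (std_gaussian :: (real ^ 'n) measure) = sets borel"
  by (simp add: std_gaussian_def)

lemma space_std_gaussian [simp]: "space (std_gaussian :: (real ^ 'n) measure) = UNIV"
  by (simp add: std_gaussian_def)

lemma prob_space_std_gaussian: "prob_space (std_gaussian :: (real ^ 'n) measure)"
  unfolding std_gaussian_def by (rule std_normals.P.prob_space_distr) measurable

lemma integral_std_gaussian_prod:
  fixes f :: "'n::finite \<Rightarrow> real \<Rightarrow> 'b::{real_normed_field, banach, second_countable_topology}"
  assumes "\<And>i. integrable std_normal_distribution (f i)"
  shows "(\<integral>z. (\<Prod>i\<in>UNIV. f i (z $ i)) \<partial>std_gaussian) = (\<Prod>i\<in>UNIV. \<integral>x. f i x \<partial>std_normal_distribution)"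
proof -
  have [measurable]: "f i \<in> borel_measurable borel" for i
    using borel_measurable_integrable[OF assms[of i]] by simp
  have "(\<integral>z. (\<Prod>i\<in>UNIV. f i (z $ i)) \<partial>std_gaussian)
      = (\<integral>w. (\<Prod>i\<in>UNIV. f i (w i)) \<partial>Pi\<^sub>M UNIV (\<lambda>_. std_normal_distribution))"
    unfolding std_gaussian_def by (subst integral_distr) (auto intro!: borel_measurable_prod)
  also have "\<dots> = (\<Prod>i\<in>UNIV. \<integral>x. f i x \<partial>std_normal_distribution)"
    by (rule std_normals.product_integral_prod) (use assms in auto)
  finally show ?thesis .
qed

lemma char_std_gaussian:
  "(CLINT z | std_gaussian. iexp (y \<bullet> z)) = complex_of_real (exp (- (norm y)\<^sup>2 / 2))" for y :: "real ^ 'n"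
proof -
  have iexp_prod: "iexp (y \<bullet> z) = (\<Prod>i\<in>UNIV. iexp (y $ i * z $ i))" for z
    by (simp add: inner_vec_def exp_sum[symmetric] sum_distrib_left)
  have I: "integrable std_normal_distribution (\<lambda>x. iexp (c * x))" for c
    by (rule std_normal.integrable_const_bound[of _ 1]) auto
  have "(CLINT z | std_gaussian. iexp (y \<bullet> z)) = (\<Prod>i\<in>UNIV. CLINT x | std_normal_distribution. iexp (y $ i * x))"
    unfolding iexp_prod by (rule integral_std_gaussian_prod) (rule I)
  also have "\<dots> = (\<Prod>i\<in>UNIV. complex_of_real (exp (- (y $ i)\<^sup>2 / 2)))"
    using char_std_normal_distribution by (simp add: char_def fun_eq_iff)
  also have "\<dots> = complex_of_real (exp (\<Sum>i\<in>UNIV. - (y $ i)\<^sup>2 / 2))"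
    by (simp add: exp_sum)
  also have "(\<Sum>i\<in>UNIV. - (y $ i)\<^sup>2 / 2) = - (norm y)\<^sup>2 / 2"
    by (simp add: norm_vec_def L2_set_def sum_nonneg sum_negf sum_divide_distrib)
  finally show ?thesis .
qed

text \<open>
  Multiplying the normal density by \<open>exp (- (s * x\<^sup>2))\<close> gives a normal density of variance
  \<open>1 / (1 + 2 * s)\<close>, up to the factor that normalizes it.
\<close>

lemma Laplace_std_normal_square:
  fixes s :: real
  assumes s: "0 < s"
  shows "(\<integral>x. exp (- (s * x\<^sup>2)) \<partial>std_normal_distribution) = (1 + 2 * s) powr (- (1 / 2))"
proof -
  define \<sigma> where "\<sigma> = inverse (sqrt (1 + 2 * s))"
  have \<sigma>: "\<sigma> > 0" "\<sigma>\<^sup>2 = inverse (1 + 2 * s)" using s by (auto simp: \<sigma>_def power_inverse)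
  have "(\<integral>x. exp (- (s * x\<^sup>2)) \<partial>std_normal_distribution) = (\<integral>x. std_normal_density x * exp (- (s * x\<^sup>2)) \<partial>lborel)"
    by (subst integral_density) auto
  also have "\<dots> = (\<integral>x. \<sigma> * normal_density 0 \<sigma> x \<partial>lborel)"
  proof (rule Bochner_Integration.integral_cong[OF refl])
    fix x :: real
    have "normal_density 0 \<sigma> x * \<sigma> = 1 / sqrt (2 * pi) * exp (- (x\<^sup>2 * (1 + 2 * s) / 2))"
    proof -
      have "x\<^sup>2 / (2 * \<sigma>\<^sup>2) = x\<^sup>2 * (1 + 2 * s) / 2"
        unfolding \<sigma>(2) using s by (simp add: field_simps)
      then show ?thesis
        using \<sigma>(1) by (simp add: normal_density_def real_sqrt_mult)
    qed
    also have "\<dots> = std_normal_density x * exp (- (s * x\<^sup>2))"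
      by (simp add: std_normal_density_def mult_exp_exp algebra_simps add_divide_distrib)
    finally show "std_normal_density x * exp (- (s * x\<^sup>2)) = \<sigma> * normal_density 0 \<sigma> x"
      by (simp add: mult.commute)
  qed
  also have "\<dots> = \<sigma>" using \<sigma> by simp
  also have "\<sigma> = (1 + 2 * s) powr (- (1 / 2))"
    using s by (simp add: \<sigma>_def powr_minus powr_half_sqrt)
  finally show ?thesis .
qed

lemma Laplace_std_gaussian_square:
  fixes s :: real
  assumes s: "0 < s"
  shows "(\<integral>z. exp (- (s * (norm z)\<^sup>2)) \<partial>(std_gaussian :: (real ^ 'n) measure)) = (1 + 2 * s) powr (- (real CARD('n) / 2))"
proof -
  have I: "integrable std_normal_distribution (\<lambda>x. exp (- (s * x\<^sup>2)))"
    by (rule std_normal.integrable_const_bound[of _ 1]) (use s in auto)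
  have "exp (- (s * (norm z)\<^sup>2)) = (\<Prod>i\<in>UNIV. exp (- (s * (z $ i)\<^sup>2)))" for z :: "real ^ 'n"
    by (simp add: norm_vec_def L2_set_def sum_nonneg sum_distrib_left sum_negf exp_sum[symmetric])
  then have "(\<integral>z. exp (- (s * (norm z)\<^sup>2)) \<partial>(std_gaussian :: (real ^ 'n) measure))
     = (\<Prod>i\<in>(UNIV::'n set). \<integral>x. exp (- (s * x\<^sup>2)) \<partial>std_normal_distribution)"
    using integral_std_gaussian_prod[OF I] by simp
  also have "\<dots> = ((1 + 2 * s) powr (- (1 / 2))) powr real CARD('n)"
    using s by (simp add: Laplace_std_normal_square powr_realpow)
  also have "\<dots> = (1 + 2 * s) powr (- (real CARD('n) / 2))"
    by (simp add: powr_powr)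
  finally show ?thesis .
qed

lemma distr_std_normals_component:
  "distr (Pi\<^sub>M UNIV (\<lambda>_. std_normal_distribution)) std_normal_distribution (\<lambda>w. w i) = std_normal_distribution"
  for i :: "'n::finite"
  using distr_PiM_component[of UNIV "\<lambda>_. std_normal_distribution" i] std_normal.prob_space_axioms by simp

lemma integrable_std_gaussian_norm_square:
  "integrable (std_gaussian :: (real ^ 'n) measure) (\<lambda>z. (norm z)\<^sup>2)"
proof -
  have "integrable std_normal_distribution (\<lambda>x. x\<^sup>2)"
    using integrable_std_normal_moment[of 2] by (subst integrable_density) auto
  then have "integrable (distr (Pi\<^sub>M UNIV (\<lambda>_. std_normal_distribution)) std_normal_distribution (\<lambda>w. w i)) (\<lambda>x. x\<^sup>2)" for i :: 'n
    unfolding distr_std_normals_component .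
  then have "integrable (Pi\<^sub>M UNIV (\<lambda>_. std_normal_distribution)) (\<lambda>w. (w i)\<^sup>2)" for i :: 'n
    by (subst (asm) integrable_distr_eq) auto
  then have "integrable (Pi\<^sub>M UNIV (\<lambda>_. std_normal_distribution)) (\<lambda>w. (norm (\<chi> i::'n. w i))\<^sup>2)"
    by (simp add: norm_vec_def L2_set_def sum_nonneg)
  then show ?thesis
    unfolding std_gaussian_def by (subst integrable_distr_eq) auto
qed

lemma AE_std_gaussian_nonzero: "AE z in (std_gaussian :: (real ^ 'n) measure). z \<noteq> 0"
proof -
  fix i :: 'n
  have "AE x in std_normal_distribution. x \<noteq> 0"
    using AE_lborel_singleton[of "0::real"] by (subst AE_density) auto
  then have "AE x in distr (Pi\<^sub>M UNIV (\<lambda>_. std_normal_distribution)) std_normal_distribution (\<lambda>w. w i). x \<noteq> 0"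
    unfolding distr_std_normals_component .
  then have "AE w in Pi\<^sub>M UNIV (\<lambda>_. std_normal_distribution). w i \<noteq> 0"
    by (subst (asm) AE_distr_iff) auto
  then have "AE w in Pi\<^sub>M UNIV (\<lambda>_. std_normal_distribution). (\<chi> i::'n. w i) \<noteq> 0"
    by eventually_elim (auto simp: vec_eq_iff)
  then show ?thesis
    unfolding std_gaussian_def by (subst AE_distr_iff) auto
qed

text \<open>
  Half the squared norm of a Gaussian vector in dimension \<open>d\<close> has the Laplace transform of the Gamma
  distribution with shape \<open>d / 2\<close>. Their fractional moments therefore agree, and those of the Gamma
  distribution are quotients of values of the Gamma function.
\<close>

lemma std_gaussian_norm_moment:
  fixes b :: real
  assumes b: "0 \<le> b" "b < 1"
  shows "has_bochner_integral (std_gaussian :: (real ^ 'n) measure) (\<lambda>z. norm z powr (2 * b))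
           (2 powr b * Gamma (real CARD('n) / 2 + b) / Gamma (real CARD('n) / 2))"
proof (cases "b = 0")
  case True
  have "Gamma (real CARD('n) / 2) > 0"
    by (rule Gamma_real_pos) simp
  then have [simp]: "Gamma (real CARD('n) / 2) \<noteq> 0"
    by linarith
  interpret prob_space "std_gaussian :: (real ^ 'n) measure" by (rule prob_space_std_gaussian)
  have "has_bochner_integral (std_gaussian :: (real ^ 'n) measure) (\<lambda>_. 1 :: real) 1"
    using prob_space by (simp add: has_bochner_integral_iff)
  moreover have "AE z in (std_gaussian :: (real ^ 'n) measure). norm z powr (2 * b) = 1"
    using AE_std_gaussian_nonzero by eventually_elim (simp add: True)
  ultimately show ?thesis
    using True by (subst has_bochner_integral_cong_AE) auto
next
  case False
  with b have b: "0 < b" "b < 1" by auto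
  define p where "p = real CARD('n) / 2"
  have p: "p > 0" by (simp add: p_def)
  \<comment> \<open>The Gamma distribution with shape \<open>p\<close>.\<close>
  define D where "D = density lborel (\<lambda>t::real. ennreal (indicator {0<..} t * (t powr (p - 1) * exp (- t)) / Gamma p))"
  have G: "Gamma p > 0" using p by (rule Gamma_real_pos)
  have nn_D: "(\<integral>\<^sup>+t. ennreal (indicator {0<..} t * (t powr (p - 1) * exp (- t)) / Gamma p) * ennreal (t powr q * exp (- (s * t))) \<partial>lborel)
      = ennreal (Gamma (p + q) / Gamma p * (1 + s) powr (- (p + q)))" if "q \<ge> 0" "s \<ge> 0" for q s
  proof -
    have "(\<integral>\<^sup>+t. ennreal (indicator {0<..} t * (t powr (p - 1) * exp (- t)) / Gamma p) * ennreal (t powr q * exp (- (s * t))) \<partial>lborel)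
      = (\<integral>\<^sup>+t. ennreal (1 / Gamma p) * ennreal (indicator {0<..} t * (t powr (p + q - 1) * exp (- ((1 + s) * t)))) \<partial>lborel)"
    proof (rule nn_integral_cong)
      fix t :: real
      have "t powr (p - 1) * exp (- t) * (t powr q * exp (- (s * t))) = t powr (p + q - 1) * exp (- ((1 + s) * t))"
      proof -
        have "t powr (p - 1) * t powr q = t powr (p + q - 1)"
          by (simp add: powr_add[symmetric] algebra_simps)
        moreover have "exp (- t) * exp (- (s * t)) = exp (- ((1 + s) * t))"
          by (simp add: exp_add[symmetric] algebra_simps)
        ultimately show ?thesis by (metis mult.assoc mult.left_commute)
      qed
      then have "indicator {0<..} t * (t powr (p - 1) * exp (- t)) / Gamma p * (t powr q * exp (- (s * t)))
          = 1 / Gamma p * (indicator {0<..} t * (t powr (p + q - 1) * exp (- ((1 + s) * t))))"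
        by (simp add: indicator_def)
      then show "ennreal (indicator {0<..} t * (t powr (p - 1) * exp (- t)) / Gamma p) * ennreal (t powr q * exp (- (s * t)))
          = ennreal (1 / Gamma p) * ennreal (indicator {0<..} t * (t powr (p + q - 1) * exp (- ((1 + s) * t))))"
        using G by (simp flip: ennreal_mult)
    qed
    also have "\<dots> = ennreal (1 / Gamma p) * ennreal (Gamma (p + q) * (1 + s) powr (- (p + q)))"
      using p that by (subst nn_integral_cmult) (auto simp: nn_integral_powr_exp)
    finally show ?thesis
      using G p that by (simp add: Gamma_real_nonneg flip: ennreal_mult)
  qed
  have nn_D': "(\<integral>\<^sup>+t. ennreal (t powr q * exp (- (s * t))) \<partial>D) = ennreal (Gamma (p + q) / Gamma p * (1 + s) powr (- (p + q)))"
    if "q \<ge> 0" "s \<ge> 0" for q s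
    unfolding nn_D[OF that, symmetric] D_def by (rule nn_integral_density) auto
  have AE_D: "AE t in D. 0 < t"
    unfolding D_def by (subst AE_density) (auto intro!: AE_I2 simp: indicator_def split: if_splits)
  have nn_D0: "(\<integral>\<^sup>+t. ennreal (exp (- (s * t))) \<partial>D) = ennreal ((1 + s) powr (- p))" if "s \<ge> 0" for s
  proof -
    have "(\<integral>\<^sup>+t. ennreal (exp (- (s * t))) \<partial>D) = (\<integral>\<^sup>+t. ennreal (t powr 0 * exp (- (s * t))) \<partial>D)"
      by (rule nn_integral_cong_AE) (use AE_D in eventually_elim, simp)
    then show ?thesis using nn_D'[of 0 s] that G by simp
  qed
  have D: "prob_space D"
    using nn_D0[of 0] by (intro prob_spaceI) simp
  have "(\<integral>\<^sup>+z. ennreal (((norm z)\<^sup>2) powr b) \<partial>(std_gaussian :: (real ^ 'n) measure)) = (\<integral>\<^sup>+t. ennreal ((2 * t) powr b) \<partial>D)"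
  proof (rule nn_integral_powr_eq_of_Laplace[OF prob_space_std_gaussian D _ _ _ _ _ b])
    show "AE t in D. 0 \<le> 2 * t" using AE_D by eventually_elim simp
    show "(\<integral>z. exp (- (s * (norm z)\<^sup>2)) \<partial>(std_gaussian :: (real ^ 'n) measure)) = (\<integral>t. exp (- (s * (2 * t))) \<partial>D)"
      if "s > 0" for s
    proof -
      have "(\<integral>t. exp (- (s * (2 * t))) \<partial>D) = enn2real (\<integral>\<^sup>+t. ennreal (exp (- (2 * s * t))) \<partial>D)"
        by (subst integral_eq_nn_integral) (auto simp: D_def mult_ac)
      then show ?thesis
        using nn_D0[of "2 * s"] that by (simp add: Laplace_std_gaussian_square p_def)
    qed
  qed (auto simp: D_def)
  also have "(\<integral>\<^sup>+t. ennreal ((2 * t) powr b) \<partial>D) = (\<integral>\<^sup>+t. ennreal (2 powr b) * ennreal (t powr b * exp (- (0 * t))) \<partial>D)"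
    by (rule nn_integral_cong_AE) (use AE_D in eventually_elim, simp add: powr_mult flip: ennreal_mult)
  also have "\<dots> = ennreal (2 powr b) * ennreal (Gamma (p + b) / Gamma p)"
    using b nn_D'[of b 0] by (subst nn_integral_cmult) (auto simp: D_def)
  also have "\<dots> = ennreal (2 powr b * Gamma (p + b) / Gamma p)"
    using G p b by (simp add: Gamma_real_nonneg flip: ennreal_mult)
  finally have moment_D: "(\<integral>\<^sup>+z. ennreal (((norm z)\<^sup>2) powr b) \<partial>(std_gaussian :: (real ^ 'n) measure)) = ennreal (2 powr b * Gamma (p + b) / Gamma p)" .
  have "(\<integral>\<^sup>+z. ennreal (norm z powr (2 * b)) \<partial>(std_gaussian :: (real ^ 'n) measure)) = ennreal (2 powr b * Gamma (p + b) / Gamma p)"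
  proof -
    have "norm z powr (2 * b) = ((norm z)\<^sup>2) powr b" for z :: "real ^ 'n"
      by (simp add: powr_powr[of "norm z" 2 b, symmetric])
    then show ?thesis using moment_D by (simp only:)
  qed
  then show ?thesis
    using G p b unfolding p_def[symmetric]
    by (intro has_bochner_integral_nn_integral) (auto simp: Gamma_real_nonneg)
qed

section \<open>Regular variation\<close>

lemma regularly_varying_at_zero_eventually_pos:
  assumes "regularly_varying_at_zero \<alpha> f"
  shows "\<forall>\<^sub>F r in at_right 0. 0 < f r"
proof -
  obtain x0 where "x0 > 0" "\<forall>x\<ge>x0. inverse (f (inverse x)) > 0"
    using assms unfolding regularly_varying_at_zero_def regularly_varying_at_infinity_def by blast
  then have "\<forall>\<^sub>F x in at_top. 0 < f (inverse x)"
    unfolding eventually_at_top_linorder by auto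
  then show ?thesis by (simp add: eventually_at_right_to_top)
qed

lemma regularly_varying_at_zero_tendsto:
  assumes "regularly_varying_at_zero \<alpha> f" "c > 0"
  shows "((\<lambda>r. f (c * r) / f r) \<longlongrightarrow> c powr \<alpha>) (at_right 0)"
proof -
  have "((\<lambda>x. inverse (f (inverse (inverse c * x))) / inverse (f (inverse x))) \<longlongrightarrow> inverse c powr \<alpha>) at_top"
    using assms unfolding regularly_varying_at_zero_def regularly_varying_at_infinity_def
    by (metis positive_imp_inverse_positive)
  then have "((\<lambda>x. inverse (inverse (f (inverse (inverse c * x))) / inverse (f (inverse x)))) \<longlongrightarrow> inverse (inverse c powr \<alpha>)) at_top"
    using assms(2) by (intro tendsto_inverse) auto
  then show ?thesis
    using assms(2) unfolding filterlim_at_right_to_top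
    by (simp add: divide_inverse mult.commute inverse_powr powr_minus)
qed

text \<open>
  A quantitative form of the uniform convergence theorem for regularly varying functions, for functions
  whose square roots are subadditive up to a constant. Pointwise convergence on \<open>[1, 3]\<close> makes \<open>h n u \<le> K\<close> fail only
  on a set \<open>A n\<close> of small measure. By Steinhaus' argument each \<open>l\<close> in \<open>[0, 1]\<close> is then a
  difference of two points outside \<open>A n\<close>, and the inequality for differences bounds \<open>h n l\<close>. Larger \<open>l\<close>
  are reached by doubling, each step of which costs a factor \<open>4\<close>, which is why the growth is quadratic.
\<close>

lemma eventually_quadratic_bound:
  fixes h :: "nat \<Rightarrow> real \<Rightarrow> real"
  assumes meas: "\<And>n. h n \<in> borel_measurable borel"
    and nonneg: "\<And>n x. 0 \<le> h n x"
    and add: "\<And>n x y. h n (x + y) \<le> 2 * (h n x + h n y)"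
    and diff: "\<And>n x y. h n (x - y) \<le> 2 * (h n x + h n y)"
    and lim: "\<And>u. 1 \<le> u \<Longrightarrow> u \<le> 3 \<Longrightarrow> (\<lambda>n. h n u) \<longlonglongrightarrow> w u"
    and K: "\<And>u. 1 \<le> u \<Longrightarrow> u \<le> 3 \<Longrightarrow> w u < K"
  shows "\<forall>\<^sub>F n in sequentially. \<forall>l\<ge>0. h n l \<le> 16 * K * max 1 (l\<^sup>2)"
proof -
  note [measurable] = meas
  define A where "A n = {u \<in> {1..3}. K < h n u}" for n
  have A [measurable]: "A n \<in> sets lborel" for n
    unfolding A_def by measurable
  have A_fin: "emeasure lborel (A n) < \<infinity>" for n
    by (rule le_less_trans[OF emeasure_mono[of _ "{1..3}"]]) (auto simp: A_def)
  have "(\<lambda>n. \<integral>u. indicator (A n) u \<partial>lborel) \<longlonglongrightarrow> (\<integral>u. (0::real) \<partial>(lborel :: real measure))"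
  proof (rule integral_dominated_convergence[where w = "indicator {1..3}"])
    show "AE u in lborel. (\<lambda>n. indicator (A n) u) \<longlonglongrightarrow> (0::real)"
    proof (rule AE_I2)
      fix u :: real
      show "(\<lambda>n. indicator (A n) u) \<longlonglongrightarrow> (0::real)"
      proof (cases "u \<in> {1..3}")
        case True
        then have "\<forall>\<^sub>F n in sequentially. h n u < K"
          using order_tendstoD(2)[OF lim K] by auto
        then have "\<forall>\<^sub>F n in sequentially. indicator (A n) u = (0::real)"
          by eventually_elim (auto simp: A_def)
        then show ?thesis by (rule tendsto_eventually)
      qed (auto simp: A_def)
    qed
    show "AE u in lborel. norm (indicator (A n) u :: real) \<le> indicator {1..3} u" for n
      by (auto simp: A_def indicator_def)
  qed (auto intro!: integrable_real_indicator)
  then have "(\<lambda>n. measure lborel (A n)) \<longlonglongrightarrow> 0"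
    using A_fin by simp
  then have "\<forall>\<^sub>F n in sequentially. measure lborel (A n) < 1 / 2"
    by (rule order_tendstoD(2)) simp
  then show ?thesis
  proof eventually_elim
    case (elim n)
    have unit: "h n l \<le> 4 * K" if l: "0 \<le> l" "l \<le> 1" for l
    proof -
      \<comment> \<open>Otherwise \<open>A n\<close> and its translate by \<open>- l\<close>, each of measure below \<open>1 / 2\<close>, would cover
        an interval of length \<open>1\<close>.\<close>
      have "\<exists>u\<in>{1..2}. u \<notin> A n \<and> u + l \<notin> A n"
      proof (rule ccontr)
        assume "\<not> ?thesis"
        then have sub: "{1..2} \<subseteq> A n \<union> ((\<lambda>u. l + u) -` A n)"
          by (auto simp: add.commute)
        have img_sets: "(\<lambda>u. l + u) -` A n \<in> sets lborel"
          using measurable_sets[of "\<lambda>u. l + u" lborel lborel "A n"] A[of n] by simp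
        have img_measure: "emeasure lborel ((\<lambda>u. l + u) -` A n) = emeasure lborel (A n)"
          using lborel_distr_plus[of l] emeasure_distr[of "(+) l" lborel borel "A n"] A[of n] by simp
        have "ennreal 1 = emeasure lborel {1..2::real}" by simp
        also have "\<dots> \<le> emeasure lborel (A n \<union> ((\<lambda>u. l + u) -` A n))"
          using sub A img_sets by (intro emeasure_mono) auto
        also have "\<dots> \<le> emeasure lborel (A n) + emeasure lborel (A n)"
          using emeasure_subadditive[OF A img_sets, of n] img_measure by simp
        also have "\<dots> = ennreal (2 * measure lborel (A n))"
          using A_fin[of n] by (simp add: emeasure_eq_ennreal_measure ennreal_plus[symmetric] del: ennreal_plus)
        also have "\<dots> < ennreal 1"
          using elim by (intro ennreal_lessI) auto
        finally show False by simp
      qed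
      then obtain u where u: "1 \<le> u" "u \<le> 2" "u \<notin> A n" "u + l \<notin> A n" by auto
      then have "h n u \<le> K" "h n (u + l) \<le> K"
        using l by (auto simp: A_def)
      then show ?thesis using diff[of n "u + l" u] by simp
    qed
    have "K \<ge> 0" using unit[of 0] nonneg[of n 0] by simp
    have double: "h n (2 * x) \<le> 4 * h n x" for x
      using add[of n x x] by simp
    have "h n l \<le> 16 * K * max 1 (l\<^sup>2)" if "0 \<le> l" "l \<le> 2 ^ k" for l k
      using that
    proof (induction k arbitrary: l)
      case 0
      then show ?case using unit[of l] \<open>K \<ge> 0\<close> mult_left_mono[of 1 "max 1 (l\<^sup>2)" "16 * K"] by simp
    next
      case (Suc k)
      show ?case
      proof (cases "l \<le> 2")
        case True
        have "h n l \<le> 16 * K" using unit[of "l / 2"] double[of "l / 2"] Suc.prems True by simp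
        then show ?thesis using \<open>K \<ge> 0\<close> mult_left_mono[of 1 "max 1 (l\<^sup>2)" "16 * K"] by simp
      next
        case False
        have 1: "max 1 ((l / 2)\<^sup>2) = l\<^sup>2 / 4" "max 1 (l\<^sup>2) = l\<^sup>2"
          using False power_mono[of 2 l 2] by (auto simp: power_divide)
        have "h n (l / 2) \<le> 16 * K * max 1 ((l / 2)\<^sup>2)"
          using Suc.prems by (intro Suc.IH) auto
        then show ?thesis using double[of "l / 2"] unfolding 1 by simp
      qed
    qed
    then show ?case
      using real_arch_pow[of 2] by (meson less_imp_le one_less_numeral_iff semiring_norm(76))
  qed
qed

section \<open>Exponents of Levy processes\<close>

text \<open>
  Since \<open>1 - cos a = 2 * (sin (a / 2))\<^sup>2\<close>, this is the subadditivity of \<open>\<bar>sin\<bar>\<close> after squaring.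
\<close>

lemma one_minus_cos_add_le: "1 - cos (a + b) \<le> 2 * ((1 - cos a) + (1 - cos b))" for a b :: real
proof -
  have half: "1 - cos x = 2 * (sin (x / 2))\<^sup>2" for x :: real
    using cos_double_sin[of "x / 2"] by simp
  have "\<bar>sin (a / 2 + b / 2)\<bar> \<le> \<bar>sin (a / 2)\<bar> * \<bar>cos (b / 2)\<bar> + \<bar>cos (a / 2)\<bar> * \<bar>sin (b / 2)\<bar>"
    unfolding sin_add by (metis abs_mult abs_triangle_ineq)
  also have "\<dots> \<le> \<bar>sin (a / 2)\<bar> * 1 + 1 * \<bar>sin (b / 2)\<bar>"
    by (intro add_mono mult_mono) auto
  finally have "(sin ((a + b) / 2))\<^sup>2 \<le> (\<bar>sin (a / 2)\<bar> + \<bar>sin (b / 2)\<bar>)\<^sup>2"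
    by (simp add: add_divide_distrib abs_le_square_iff[symmetric])
  also have "\<dots> \<le> 2 * (sin (a / 2))\<^sup>2 + 2 * (sin (b / 2))\<^sup>2"
    using zero_le_power2[of "\<bar>sin (a / 2)\<bar> - \<bar>sin (b / 2)\<bar>"] by (simp add: power2_sum power2_diff)
  finally show ?thesis unfolding half by simp
qed

text \<open>
  The integrand is at most \<open>2\<close> and at most \<open>(norm \<xi>)\<^sup>2 * (norm x)\<^sup>2\<close>, hence bounded by a multiple of
  the function \<open>min 1 ((norm x)\<^sup>2)\<close> that a Levy measure integrates.
\<close>

lemma levy_measure_integrable_one_minus_cos:
  fixes \<nu> :: "(real ^ 'n) measure"
  assumes "levy_measure \<nu>"
  shows "integrable \<nu> (\<lambda>x. 1 - cos (\<xi> \<bullet> x))"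
proof -
  have [measurable_cong]: "sets \<nu> = sets borel"
    and fin: "(\<integral>\<^sup>+x. ennreal (min 1 ((norm x)\<^sup>2)) \<partial>\<nu>) < \<infinity>"
    using assms unfolding levy_measure_def by auto
  have "integrable \<nu> (\<lambda>x. min 1 ((norm x)\<^sup>2))"
    using fin by (intro integrableI_nonneg) auto
  then have "integrable \<nu> (\<lambda>x. (2 + (norm \<xi>)\<^sup>2) * min 1 ((norm x)\<^sup>2))"
    by (rule integrable_mult_right)
  then show ?thesis
  proof (rule Bochner_Integration.integrable_bound)
    show "AE x in \<nu>. norm (1 - cos (\<xi> \<bullet> x)) \<le> norm ((2 + (norm \<xi>)\<^sup>2) * min 1 ((norm x)\<^sup>2))"
    proof (rule AE_I2)
      fix x
      have 1: "1 - cos (\<xi> \<bullet> x) \<le> 2" using cos_ge_minus_one[of "\<xi> \<bullet> x"] by simp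
      have "1 - cos (\<xi> \<bullet> x) = 2 * (sin ((\<xi> \<bullet> x) / 2))\<^sup>2"
        using cos_double_sin[of "(\<xi> \<bullet> x) / 2"] by simp
      also have "\<dots> \<le> 2 * ((\<xi> \<bullet> x) / 2)\<^sup>2"
        using abs_sin_x_le_abs_x[of "(\<xi> \<bullet> x) / 2"] by (intro mult_left_mono abs_le_square_iff[THEN iffD1]) auto
      also have "\<dots> \<le> (\<xi> \<bullet> x)\<^sup>2"
        by (simp add: power_divide)
      also have "\<dots> \<le> (norm \<xi> * norm x)\<^sup>2"
        using power_mono[OF Cauchy_Schwarz_ineq2[of \<xi> x], of 2] by simp
      finally have 2: "1 - cos (\<xi> \<bullet> x) \<le> (norm \<xi>)\<^sup>2 * (norm x)\<^sup>2" by (simp add: power_mult_distrib)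
      have "1 - cos (\<xi> \<bullet> x) \<le> (2 + (norm \<xi>)\<^sup>2) * min 1 ((norm x)\<^sup>2)"
      proof (cases "1 \<le> (norm x)\<^sup>2")
        case True
        then have "(2 + (norm \<xi>)\<^sup>2) * min 1 ((norm x)\<^sup>2) = 2 + (norm \<xi>)\<^sup>2" by simp
        then show ?thesis using 1 zero_le_power2[of "norm \<xi>"] by linarith
      next
        case False
        then have "(2 + (norm \<xi>)\<^sup>2) * min 1 ((norm x)\<^sup>2) = 2 * (norm x)\<^sup>2 + (norm \<xi>)\<^sup>2 * (norm x)\<^sup>2"
          by (simp add: distrib_right)
        then show ?thesis using 2 zero_le_power2[of "norm x"] by linarith
      qed
      then show "norm (1 - cos (\<xi> \<bullet> x)) \<le> norm ((2 + (norm \<xi>)\<^sup>2) * min 1 ((norm x)\<^sup>2))"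
        by (simp add: abs_mult)
    qed
  qed measurable
qed

lemma levy_khintchine_exponent_nonneg:
  assumes "levy_khintchine_exponent M X \<psi>"
  shows "0 \<le> \<psi> \<xi>"
proof -
  obtain \<eta> \<nu> where "\<eta> \<ge> 0" "\<And>\<xi>. \<psi> \<xi> = (\<integral>x. (1 - cos (\<xi> \<bullet> x)) \<partial>\<nu>) + \<eta> * (norm \<xi>)\<^sup>2"
    using assms unfolding levy_khintchine_exponent_def by blast
  then show ?thesis by (simp add: integral_nonneg_AE)
qed

lemma levy_khintchine_exponent_add_le:
  fixes \<psi> :: "real ^ 'n \<Rightarrow> real"
  assumes "levy_khintchine_exponent M X \<psi>"
  shows "\<psi> (\<xi> + \<zeta>) \<le> 2 * (\<psi> \<xi> + \<psi> \<zeta>)"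
proof -
  obtain \<eta> \<nu> where \<eta>: "\<eta> \<ge> 0" and \<nu>: "levy_measure \<nu>"
    and \<psi>: "\<And>\<xi>. \<psi> \<xi> = (\<integral>x. (1 - cos (\<xi> \<bullet> x)) \<partial>\<nu>) + \<eta> * (norm \<xi>)\<^sup>2"
    using assms unfolding levy_khintchine_exponent_def by blast
  note I = levy_measure_integrable_one_minus_cos[OF \<nu>]
  have "(\<integral>x. (1 - cos ((\<xi> + \<zeta>) \<bullet> x)) \<partial>\<nu>) \<le> (\<integral>x. 2 * ((1 - cos (\<xi> \<bullet> x)) + (1 - cos (\<zeta> \<bullet> x))) \<partial>\<nu>)"
    by (intro integral_mono I integrable_mult_right Bochner_Integration.integrable_add)
      (use one_minus_cos_add_le in \<open>simp add: inner_add_left\<close>)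
  also have "\<dots> = 2 * ((\<integral>x. (1 - cos (\<xi> \<bullet> x)) \<partial>\<nu>) + (\<integral>x. (1 - cos (\<zeta> \<bullet> x)) \<partial>\<nu>))"
    using Bochner_Integration.integral_add[OF I[of \<xi>] I[of \<zeta>]] by (simp only: integral_mult_right_zero)
  finally have 1: "(\<integral>x. (1 - cos ((\<xi> + \<zeta>) \<bullet> x)) \<partial>\<nu>) \<le> \<dots>" .
  have "(norm (\<xi> + \<zeta>))\<^sup>2 \<le> (norm \<xi> + norm \<zeta>)\<^sup>2"
    by (intro power_mono norm_triangle_ineq norm_ge_zero)
  also have "\<dots> \<le> 2 * ((norm \<xi>)\<^sup>2 + (norm \<zeta>)\<^sup>2)"
    using zero_le_power2[of "norm \<xi> - norm \<zeta>"] by (simp add: power2_sum power2_diff)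
  finally have "\<eta> * (norm (\<xi> + \<zeta>))\<^sup>2 \<le> \<eta> * (2 * ((norm \<xi>)\<^sup>2 + (norm \<zeta>)\<^sup>2))"
    using \<eta> by (rule mult_left_mono)
  with 1 show ?thesis unfolding \<psi> by (simp add: algebra_simps)
qed

lemma levy_khintchine_exponent_minus:
  fixes \<psi> :: "real ^ 'n \<Rightarrow> real"
  assumes "levy_khintchine_exponent M X \<psi>"
  shows "\<psi> (- \<xi>) = \<psi> \<xi>"
  by (rule levy_khintchine_exponent_radial[OF assms]) simp

text \<open>
  The exponent is minus the logarithm of the characteristic function at time \<open>1\<close>, which is an
  integral over a finite measure and hence measurable in its parameter.
\<close>

lemma levy_khintchine_exponent_measurable:
  fixes \<psi> :: "real ^ 'n \<Rightarrow> real"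
  assumes "levy_process M X" "levy_khintchine_exponent M X \<psi>"
  shows "\<psi> \<in> borel_measurable borel"
proof -
  interpret levy_process M X by fact
  define \<mu> where "\<mu> = distr M borel (X 1)"
  have [measurable_cong]: "sets \<mu> = sets borel" by (simp add: \<mu>_def)
  interpret \<mu>: prob_space \<mu>
    unfolding \<mu>_def using measurable_X[of 1] by (intro prob_space_distr) simp
  have "(CLINT x | \<mu>. iexp (\<xi> \<bullet> x)) = exp (- complex_of_real (1 * \<psi> \<xi>))" for \<xi>
    using assms(2) unfolding levy_khintchine_exponent_def \<mu>_def by (metis zero_le_one)
  then have "\<psi> = (\<lambda>\<xi>. - ln (Re (CLINT x | \<mu>. iexp (\<xi> \<bullet> x))))"
    by (simp add: fun_eq_iff exp_of_real flip: of_real_minus)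
  moreover have "(\<lambda>\<xi>. CLINT x | \<mu>. iexp (\<xi> \<bullet> x)) \<in> borel_measurable borel"
    by measurable
  then have "(\<lambda>\<xi>. - ln (Re (CLINT x | \<mu>. iexp (\<xi> \<bullet> x)))) \<in> borel_measurable borel"
    by measurable
  ultimately show ?thesis by simp
qed

text \<open>
  A Gaussian function is its own Fourier transform: write \<open>exp (- (a * norm x)\<^sup>2 / 2)\<close> as the
  characteristic function of a standard Gaussian \<open>z\<close> at \<open>a x\<close> and integrate over \<open>x\<close> first. This turns
  the Laplace transform of the squared norm into an average of the characteristic function.
\<close>

lemma Laplace_norm_square_eq_gaussian_mixture:
  fixes \<mu> :: "(real ^ 'n) measure" and g :: "real ^ 'n \<Rightarrow> real"
  assumes \<mu>: "prob_space \<mu>" "sets \<mu> = sets borel"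
    and g: "\<And>\<xi>. (CLINT x | \<mu>. iexp (\<xi> \<bullet> x)) = complex_of_real (g \<xi>)"
  shows "(\<integral>x. exp (- ((a * norm x)\<^sup>2 / 2)) \<partial>\<mu>) = (\<integral>z. g (a *\<^sub>R z) \<partial>std_gaussian)"
proof -
  interpret \<mu>: prob_space \<mu> by fact
  interpret \<gamma>: prob_space "std_gaussian :: (real ^ 'n) measure" by (rule prob_space_std_gaussian)
  interpret P: pair_prob_space \<mu> "std_gaussian :: (real ^ 'n) measure" ..
  note [measurable_cong] = \<mu>(2)
  have "complex_of_real (\<integral>x. exp (- ((a * norm x)\<^sup>2 / 2)) \<partial>\<mu>) = (CLINT x | \<mu>. CLINT z | std_gaussian. iexp ((a *\<^sub>R x) \<bullet> z))"
    unfolding char_std_gaussian by (simp add: power_mult_distrib)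
  also have "\<dots> = (CLINT z | std_gaussian. CLINT x | \<mu>. iexp ((a *\<^sub>R z) \<bullet> x))"
  proof (subst P.Fubini_integral[symmetric])
    show "integrable (\<mu> \<Otimes>\<^sub>M std_gaussian) (\<lambda>(x, z). iexp ((a *\<^sub>R x) \<bullet> z))"
      by (rule P.integrable_const_bound[of _ 1]) auto
  qed (simp add: inner_commute)
  also have "\<dots> = complex_of_real (\<integral>z. g (a *\<^sub>R z) \<partial>std_gaussian)"
    unfolding g by simp
  finally show ?thesis unfolding of_real_eq_iff .
qed

lemma tendsto_one_minus_exp_div:
  fixes c q :: "nat \<Rightarrow> real"
  assumes c: "c \<longlonglongrightarrow> 0" "\<And>n. 0 < c n" and q: "q \<longlonglongrightarrow> l" "\<And>n. 0 \<le> q n"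
  shows "(\<lambda>n. (1 - exp (- (c n * q n))) / c n) \<longlonglongrightarrow> l"
proof (rule tendsto_sandwich)
  show "\<forall>\<^sub>F n in sequentially. q n / (1 + c n * q n) \<le> (1 - exp (- (c n * q n))) / c n"
  proof (rule always_eventually, rule allI)
    fix n
    define x where "x = c n * q n"
    have x: "x \<ge> 0" using c(2)[of n] q(2)[of n] by (simp add: x_def)
    have "exp (- x) \<le> 1 / (1 + x)"
      using exp_ge_add_one_self[of x] x by (simp add: exp_minus divide_simps)
    then have "x / (1 + x) \<le> 1 - exp (- x)"
      using x by (simp add: field_simps)
    then show "q n / (1 + c n * q n) \<le> (1 - exp (- (c n * q n))) / c n"
      using c(2)[of n] unfolding x_def by (simp add: pos_le_divide_eq mult.commute)
  qed
  show "\<forall>\<^sub>F n in sequentially. (1 - exp (- (c n * q n))) / c n \<le> q n"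
  proof (rule always_eventually, rule allI)
    fix n
    show "(1 - exp (- (c n * q n))) / c n \<le> q n"
      using exp_ge_add_one_self[of "- (c n * q n)"] c(2)[of n] by (simp add: pos_divide_le_eq mult.commute)
  qed
  have "(\<lambda>n. q n / (1 + c n * q n)) \<longlonglongrightarrow> l / (1 + 0 * l)"
    by (intro tendsto_intros c q) simp
  then show "(\<lambda>n. q n / (1 + c n * q n)) \<longlonglongrightarrow> l" by simp
qed (rule q)

text \<open>
  To first order in \<open>c\<close> the integrand is \<open>h n (a * norm z)\<close>. The quadratic bound on \<open>h n\<close> is integrable
  against the Gaussian, so the limit may be taken inside the integral.
\<close>

lemma gaussian_mixture_tendsto:
  fixes h :: "nat \<Rightarrow> real \<Rightarrow> real" and c :: "nat \<Rightarrow> real"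
  assumes h: "\<And>n. h n \<in> borel_measurable borel" "\<And>n x. 0 \<le> h n x"
    and lim: "\<And>u. 0 < u \<Longrightarrow> (\<lambda>n. h n u) \<longlonglongrightarrow> u powr \<alpha>"
    and bound: "\<forall>\<^sub>F n in sequentially. \<forall>l\<ge>0. h n l \<le> C * max 1 (l\<^sup>2)"
    and c: "c \<longlonglongrightarrow> 0" "\<And>n. 0 < c n" and a: "0 < a"
  shows "(\<lambda>n. (\<integral>z. 1 - exp (- (c n * h n (a * norm z))) \<partial>(std_gaussian :: (real ^ 'n) measure)) / c n)
           \<longlonglongrightarrow> (\<integral>z. (a * norm z) powr \<alpha> \<partial>(std_gaussian :: (real ^ 'n) measure))"
proof -
  interpret \<gamma>: prob_space "std_gaussian :: (real ^ 'n) measure" by (rule prob_space_std_gaussian)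
  note [measurable] = h(1)
  \<comment> \<open>Dominated convergence asks for a bound at every index, so the sequence is shifted by \<open>N\<close>.\<close>
  obtain N where N: "\<And>n l. n \<ge> N \<Longrightarrow> l \<ge> 0 \<Longrightarrow> h n l \<le> C * max 1 (l\<^sup>2)"
    using bound unfolding eventually_sequentially by blast
  have "0 \<le> C" using N[of N 0] h(2)[of N 0] by simp
  have "(\<lambda>n. \<integral>z. (1 - exp (- (c (n + N) * h (n + N) (a * norm z)))) / c (n + N) \<partial>(std_gaussian :: (real ^ 'n) measure))
           \<longlonglongrightarrow> (\<integral>z. (a * norm z) powr \<alpha> \<partial>(std_gaussian :: (real ^ 'n) measure))"
  proof (rule integral_dominated_convergence[where w = "\<lambda>z. C * (1 + a\<^sup>2 * (norm z)\<^sup>2)"])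
    show "integrable std_gaussian (\<lambda>z::real^'n. C * (1 + a\<^sup>2 * (norm z)\<^sup>2))"
      using integrable_std_gaussian_norm_square by auto
    show "AE z in (std_gaussian :: (real ^ 'n) measure). (\<lambda>n. (1 - exp (- (c (n + N) * h (n + N) (a * norm z)))) / c (n + N)) \<longlonglongrightarrow> (a * norm z) powr \<alpha>"
      using AE_std_gaussian_nonzero
    proof eventually_elim
      case (elim z)
      then show ?case
        using a by (intro LIMSEQ_ignore_initial_segment tendsto_one_minus_exp_div c h lim) simp
    qed
    show "AE z in (std_gaussian :: (real ^ 'n) measure). norm ((1 - exp (- (c (n + N) * h (n + N) (a * norm z)))) / c (n + N)) \<le> C * (1 + a\<^sup>2 * (norm z)\<^sup>2)" for n
    proof (rule AE_I2)
      fix z :: "real ^ 'n"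
      let ?c = "c (n + N)" and ?q = "h (n + N) (a * norm z)"
      have "norm ((1 - exp (- (?c * ?q))) / ?c) \<le> ?q"
        using exp_ge_add_one_self[of "- (?c * ?q)"] c(2)[of "n + N"] h(2)[of "n + N" "a * norm z"]
        by (simp add: pos_divide_le_eq mult.commute)
      also have "\<dots> \<le> C * max 1 ((a * norm z)\<^sup>2)"
        using a by (intro N) auto
      also have "\<dots> \<le> C * (1 + a\<^sup>2 * (norm z)\<^sup>2)"
        using \<open>0 \<le> C\<close> by (intro mult_left_mono) (auto simp: power_mult_distrib)
      finally show "norm ((1 - exp (- (?c * ?q))) / ?c) \<le> C * (1 + a\<^sup>2 * (norm z)\<^sup>2)" .
    qed
  qed auto
  then have "(\<lambda>n. \<integral>z. (1 - exp (- (c n * h n (a * norm z)))) / c n \<partial>(std_gaussian :: (real ^ 'n) measure))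
           \<longlonglongrightarrow> (\<integral>z. (a * norm z) powr \<alpha> \<partial>(std_gaussian :: (real ^ 'n) measure))"
    by (rule LIMSEQ_offset)
  then show ?thesis by simp
qed

section \<open>Asymptotics of the tail\<close>

lemma radial_profile_exponent:
  fixes \<psi> :: "real ^ 'n \<Rightarrow> real"
  assumes "levy_process M X" "levy_khintchine_exponent M X \<psi>"
  shows "radial_profile \<psi> \<in> borel_measurable borel"
    and "0 \<le> radial_profile \<psi> x"
    and "radial_profile \<psi> (x + y) \<le> 2 * (radial_profile \<psi> x + radial_profile \<psi> y)"
    and "radial_profile \<psi> (x - y) \<le> 2 * (radial_profile \<psi> x + radial_profile \<psi> y)"
proof -
  note [measurable] = levy_khintchine_exponent_measurable[OF assms]
  show "radial_profile \<psi> \<in> borel_measurable borel"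
    unfolding radial_profile_def[abs_def] by measurable
  show "0 \<le> radial_profile \<psi> x"
    unfolding radial_profile_def by (rule levy_khintchine_exponent_nonneg[OF assms(2)])
  show add: "radial_profile \<psi> (x + y) \<le> 2 * (radial_profile \<psi> x + radial_profile \<psi> y)" for x y
    unfolding radial_profile_def scaleR_add_left by (rule levy_khintchine_exponent_add_le[OF assms(2)])
  have "radial_profile \<psi> (- y) = radial_profile \<psi> y"
    unfolding radial_profile_def using levy_khintchine_exponent_minus[OF assms(2)] by simp
  then show "radial_profile \<psi> (x - y) \<le> 2 * (radial_profile \<psi> x + radial_profile \<psi> y)"
    using add[of x "- y"] by simp
qed

lemma Laplace_levy_norm_square:
  fixes M :: "'w measure" and X :: "real \<Rightarrow> 'w \<Rightarrow> real ^ 'n"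
  assumes "levy_process M X" and "levy_khintchine_exponent M X \<psi>" and t: "0 \<le> t" and s: "0 \<le> s"
  shows "(\<integral>\<omega>. 1 - exp (- (s * (\<rho> * norm (X t \<omega>))\<^sup>2)) \<partial>M)
           = (\<integral>z. 1 - exp (- (t * radial_profile \<psi> (\<bar>\<rho>\<bar> * (sqrt (2 * s) * norm z)))) \<partial>(std_gaussian :: (real ^ 'n) measure))"
proof -
  interpret levy_process M X by fact
  note [measurable] = measurable_X[OF t] levy_khintchine_exponent_measurable[OF assms(1,2)] radial_profile_exponent(1)[OF assms(1,2)]
  interpret \<gamma>: prob_space "std_gaussian :: (real ^ 'n) measure" by (rule prob_space_std_gaussian)
  define a where "a = \<rho> * sqrt (2 * s)"
  have ch: "(CLINT x | distr M borel (X t). iexp (\<xi> \<bullet> x)) = complex_of_real (exp (- (t * \<psi> \<xi>)))" for \<xi>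
    using assms(2) t unfolding levy_khintchine_exponent_def by (simp add: exp_of_real[symmetric])
  have rad: "radial_profile \<psi> (\<bar>\<rho>\<bar> * (sqrt (2 * s) * norm z)) = \<psi> (a *\<^sub>R z)" for z
    using levy_khintchine_exponent_radial_profile[OF assms(2), of "a *\<^sub>R z"] s
    by (simp add: a_def abs_mult mult.assoc)
  have "(\<integral>x. exp (- ((a * norm x)\<^sup>2 / 2)) \<partial>distr M borel (X t)) = (\<integral>z. exp (- (t * \<psi> (a *\<^sub>R z))) \<partial>std_gaussian)"
    by (rule Laplace_norm_square_eq_gaussian_mixture[OF prob_space_distr[OF measurable_X[OF t]] _ ch]) simp
  moreover have "(\<integral>x. exp (- ((a * norm x)\<^sup>2 / 2)) \<partial>distr M borel (X t)) = (\<integral>\<omega>. exp (- ((a * norm (X t \<omega>))\<^sup>2 / 2)) \<partial>M)"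
    by (rule integral_distr) measurable
  moreover have "(a * y)\<^sup>2 / 2 = s * (\<rho> * y)\<^sup>2" for y
    using s by (simp add: a_def power_mult_distrib)
  ultimately have E: "(\<integral>\<omega>. exp (- (s * (\<rho> * norm (X t \<omega>))\<^sup>2)) \<partial>M) = (\<integral>z. exp (- (t * \<psi> (a *\<^sub>R z))) \<partial>std_gaussian)"
    by simp
  have "integrable M (\<lambda>\<omega>. exp (- (s * (\<rho> * norm (X t \<omega>))\<^sup>2)))"
    by (rule integrable_const_bound[of _ 1]) (use s in auto)
  moreover have "integrable std_gaussian (\<lambda>z. exp (- (t * \<psi> (a *\<^sub>R z))))"
    by (rule \<gamma>.integrable_const_bound[of _ 1]) (use t levy_khintchine_exponent_nonneg[OF assms(2)] in auto)
  ultimately show ?thesis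
    unfolding rad using E prob_space \<gamma>.prob_space by simp
qed

text \<open>
  The joint limit along sequences. Put \<open>c n = t n * \<psi> (r n)\<close>, \<open>V n = (r n * norm (X (t n)))\<^sup>2\<close> and let
  \<open>F n u\<close> be the probability of \<open>u \<le> V n\<close> divided by \<open>c n\<close>, so that \<open>F n 1\<close> is the quotient in
  question. The Laplace transform of \<open>F n\<close> converges to that of \<open>G u = A * u powr (- \<alpha> / 2)\<close>, and the
  continuity theorem at \<open>u = 1\<close> gives the limit \<open>A\<close>.
\<close>

lemma tail_asymptotics_sequential:
  fixes M :: "'w measure" and X :: "real \<Rightarrow> 'w \<Rightarrow> real ^ 'n" and t r :: "nat \<Rightarrow> real"
  assumes "levy_process M X" and "levy_khintchine_exponent M X \<psi>"
    and \<alpha>: "0 \<le> \<alpha>" "\<alpha> < 2" and rv: "regularly_varying_at_zero \<alpha> (radial_profile \<psi>)"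
    and t: "\<And>n. 0 < t n" and r: "\<And>n. 0 < r n" "r \<longlonglongrightarrow> 0"
    and pos: "\<And>n. 0 < radial_profile \<psi> (r n)" and small: "(\<lambda>n. t n * radial_profile \<psi> (r n)) \<longlonglongrightarrow> 0"
  shows "(\<lambda>n. measure M {\<omega> \<in> space M. norm (X (t n) \<omega>) \<ge> inverse (r n)} / (t n * radial_profile \<psi> (r n)))
    \<longlonglongrightarrow> 2 powr \<alpha> * Gamma ((real CARD('n) + \<alpha>) / 2) / (Gamma (real CARD('n) / 2) * Gamma (1 - \<alpha> / 2))"
proof -
  interpret levy_process M X by fact
  define f where "f = radial_profile \<psi>"
  define c where "c n = t n * f (r n)" for n
  define V where "V n \<omega> = (r n * norm (X (t n) \<omega>))\<^sup>2" for n \<omega>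
  define F where "F n u = prob {\<omega> \<in> space M. u \<le> V n \<omega>} / c n" for n u
  define b where "b = \<alpha> / 2"
  define m where "m = 2 powr b * Gamma (real CARD('n) / 2 + b) / Gamma (real CARD('n) / 2)"
  define A where "A = 2 powr b * m / Gamma (1 - b)"
  define G where "G u = A * u powr (- b)" for u
  note f = radial_profile_exponent[OF assms(1,2), folded f_def]
  have b: "0 \<le> b" "b < 1" "\<alpha> = 2 * b" using \<alpha> by (auto simp: b_def)
  have [measurable]: "X (t n) \<in> borel_measurable M" for n
    using measurable_X[of "t n"] t[of n] by simp
  have [measurable]: "V n \<in> borel_measurable M" for n
    unfolding V_def[abs_def] by measurable
  have V0: "0 \<le> V n \<omega>" for n \<omega> by (simp add: V_def)
  have c: "0 < c n" for n using t pos by (simp add: c_def f_def)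
  have \<Gamma>: "Gamma (1 - b) > 0" "Gamma (real CARD('n) / 2) > 0" "Gamma (real CARD('n) / 2 + b) > 0"
    using b by (intro Gamma_real_pos; simp add: add_pos_nonneg)+
  have A: "A \<ge> 0" unfolding A_def m_def using \<Gamma> by simp
  have r_right: "filterlim r (at_right 0) sequentially"
    unfolding filterlim_at using r by (simp add: less_imp_neq[symmetric])
  have ratio: "(\<lambda>n. f (u * r n) / f (r n)) \<longlonglongrightarrow> u powr \<alpha>" if "u > 0" for u
    using filterlim_compose[OF regularly_varying_at_zero_tendsto[OF rv that] r_right] by (simp add: f_def)

  \<comment> \<open>Any constant above the maximum \<open>3 powr \<alpha>\<close> of the limit \<open>u powr \<alpha>\<close> on \<open>[1, 3]\<close> will do.\<close>
  have bound: "\<forall>\<^sub>F n in sequentially. \<forall>l\<ge>0. f (l * r n) / f (r n) \<le> 16 * (3 powr \<alpha> + 1) * max 1 (l\<^sup>2)"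
  proof (rule eventually_quadratic_bound[where h = "\<lambda>n l. f (l * r n) / f (r n)" and w = "\<lambda>u. u powr \<alpha>"])
    show "(\<lambda>l. f (l * r n) / f (r n)) \<in> borel_measurable borel" for n
      using f(1) by measurable
    show "f ((x + y) * r n) / f (r n) \<le> 2 * (f (x * r n) / f (r n) + f (y * r n) / f (r n))" for n x y
      using divide_right_mono[OF f(3)[of "x * r n" "y * r n"] less_imp_le[OF pos[folded f_def]]]
      by (simp add: distrib_right add_divide_distrib)
    show "f ((x - y) * r n) / f (r n) \<le> 2 * (f (x * r n) / f (r n) + f (y * r n) / f (r n))" for n x y
      using divide_right_mono[OF f(4)[of "x * r n" "y * r n"] less_imp_le[OF pos[folded f_def]]]
      by (simp add: left_diff_distrib add_divide_distrib)
    show "u powr \<alpha> < 3 powr \<alpha> + 1" if "1 \<le> u" "u \<le> 3" for u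
      using powr_mono2[OF \<alpha>(1) _ that(2)] that(1) by simp
  qed (use ratio f(2) in auto)

  have moment: "(\<integral>z. (sqrt (2 * s) * norm z) powr \<alpha> \<partial>(std_gaussian :: (real ^ 'n) measure)) = (2 * s) powr b * m" if "s > 0" for s
  proof -
    have "(sqrt (2 * s) * norm z) powr \<alpha> = (2 * s) powr b * norm z powr (2 * b)" for z :: "real ^ 'n"
      using that by (simp add: powr_mult b(3) powr_powr powr_half_sqrt[symmetric])
    then show ?thesis
      using std_gaussian_norm_moment[OF b(1,2), where 'n = 'n] by (simp add: m_def has_bochner_integral_iff)
  qed

  have Laplace_F: "(LBINT u:{0<..}. exp (- (s * u)) * F n u)
      = (\<integral>z. 1 - exp (- (c n * (f ((sqrt (2 * s) * norm z) * r n) / f (r n)))) \<partial>(std_gaussian :: (real ^ 'n) measure)) / c n / s"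
    if s: "s > 0" for s n
  proof -
    have "c n * (f ((sqrt (2 * s) * y) * r n) / f (r n)) = t n * f (\<bar>r n\<bar> * (sqrt (2 * s) * y))" for y
      using pos[of n] r(1)[of n] by (simp add: c_def f_def mult_ac)
    then have "expectation (\<lambda>\<omega>. 1 - exp (- (s * V n \<omega>)))
      = (\<integral>z. 1 - exp (- (c n * (f ((sqrt (2 * s) * norm z) * r n) / f (r n)))) \<partial>(std_gaussian :: (real ^ 'n) measure))"
      using Laplace_levy_norm_square[OF assms(1,2) less_imp_le[OF t] less_imp_le[OF s]]
      by (simp add: V_def f_def)
    moreover have "(LBINT u:{0<..}. exp (- (s * u)) * F n u) = (LBINT u:{0<..}. exp (- (s * u)) * prob {\<omega> \<in> space M. u \<le> V n \<omega>}) / c n"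
      by (simp add: F_def)
    ultimately show ?thesis
      using Laplace_tail(2)[of "V n" s] V0 s by simp
  qed

  have Laplace_G: "set_integrable lborel {0<..} (\<lambda>u. exp (- (s * u)) * G u)"
    "(LBINT u:{0<..}. exp (- (s * u)) * G u) = (2 * s) powr b * m / s" if s: "s > 0" for s
  proof -
    have "has_bochner_integral lborel (\<lambda>u. indicator {0<..} u * (u powr (1 - b - 1) * exp (- (s * u)))) (Gamma (1 - b) * s powr (- (1 - b)))"
      using nn_integral_powr_exp[of "1 - b" s] b s \<Gamma> by (intro has_bochner_integral_nn_integral) auto
    then have "has_bochner_integral lborel (\<lambda>u. A * (indicator {0<..} u * (u powr (1 - b - 1) * exp (- (s * u))))) (A * (Gamma (1 - b) * s powr (- (1 - b))))"
      by (intro has_bochner_integral_mult_right) auto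
    also have "(\<lambda>u. A * (indicator {0<..} u * (u powr (1 - b - 1) * exp (- (s * u))))) = (\<lambda>u. indicator {0<..} u *\<^sub>R (exp (- (s * u)) * G u))"
      by (auto simp: G_def fun_eq_iff)
    also have "A * (Gamma (1 - b) * s powr (- (1 - b))) = (2 * s) powr b * m / s"
      using \<Gamma> s by (simp add: A_def powr_mult powr_diff)
    \<comment> \<open>The value of \<open>A\<close> was chosen for this identity.\<close>
    finally show "set_integrable lborel {0<..} (\<lambda>u. exp (- (s * u)) * G u)"
      "(LBINT u:{0<..}. exp (- (s * u)) * G u) = (2 * s) powr b * m / s"
      unfolding set_integrable_def set_lebesgue_integral_def by (auto simp: has_bochner_integral_iff)
  qed

  have "(\<lambda>n. F n 1) \<longlonglongrightarrow> G 1"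
  proof (rule tendsto_antimono_of_Laplace[where F = F and G = G and x = 1])
    show "0 \<le> F n x" for n x using c[of n] by (simp add: F_def)
    show "F n y \<le> F n x" if "0 < x" "x \<le> y" for n x y
      unfolding F_def using that c[of n] by (intro divide_right_mono finite_measure_mono) auto
    show "set_integrable lborel {0<..} (\<lambda>u. exp (- u) * F n u)" for n
      using set_integrable_divide[OF Laplace_tail(1)[of "V n" 1], of "c n"] V0 by (simp add: F_def)
    show "0 \<le> G x" for x using A by (simp add: G_def)
    show "G y \<le> G x" if "0 < x" "x \<le> y" for x y
      unfolding G_def using that A b by (intro mult_left_mono powr_mono2') auto
    show "set_integrable lborel {0<..} (\<lambda>u. exp (- u) * G u)"
      using Laplace_G(1)[of 1] by simp
    show "(\<lambda>n. LBINT u:{0<..}. exp (- (real k * u)) * F n u) \<longlonglongrightarrow> (LBINT u:{0<..}. exp (- (real k * u)) * G u)"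
      if "1 \<le> k" for k
    proof -
      have k: "real k > 0" using that by simp
      have "(\<lambda>n. (\<integral>z. 1 - exp (- (c n * (f ((sqrt (2 * real k) * norm z) * r n) / f (r n)))) \<partial>(std_gaussian :: (real ^ 'n) measure)) / c n)
        \<longlonglongrightarrow> (\<integral>z. (sqrt (2 * real k) * norm z) powr \<alpha> \<partial>(std_gaussian :: (real ^ 'n) measure))"
      proof (rule gaussian_mixture_tendsto[where h = "\<lambda>n l. f (l * r n) / f (r n)", OF _ _ ratio bound])
        show "(\<lambda>l. f (l * r n) / f (r n)) \<in> borel_measurable borel" for n
          using f(1) by measurable
        show "c \<longlonglongrightarrow> 0" using small by (simp add: c_def[abs_def] f_def)
      qed (use f(2) c k in auto)
      then show ?thesis
        unfolding Laplace_F[OF k] Laplace_G(2)[OF k] moment[OF k] using k by (intro tendsto_divide) auto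
    qed
    show "isCont G 1" unfolding G_def[abs_def] by (intro continuous_intros) simp
  qed simp
  moreover have "F n 1 = measure M {\<omega> \<in> space M. norm (X (t n) \<omega>) \<ge> inverse (r n)} / (t n * f (r n))" for n
  proof -
    have "1 \<le> (r n * y)\<^sup>2 \<longleftrightarrow> inverse (r n) \<le> y" if "y \<ge> 0" for y
    proof -
      have "1 \<le> (r n * y)\<^sup>2 \<longleftrightarrow> 1 \<le> r n * y"
        using abs_le_square_iff[of 1 "r n * y"] that r(1)[of n] by simp
      then show ?thesis using r(1)[of n] by (simp add: field_simps)
    qed
    then show ?thesis by (simp add: F_def V_def c_def)
  qed
  moreover have "G 1 = 2 powr \<alpha> * Gamma ((real CARD('n) + \<alpha>) / 2) / (Gamma (real CARD('n) / 2) * Gamma (1 - \<alpha> / 2))"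
  proof -
    have "2 powr b * 2 powr b = (2::real) powr \<alpha>" by (simp add: b(3) powr_add[symmetric])
    then show ?thesis by (simp add: G_def A_def m_def b_def add_divide_distrib)
  qed
  ultimately show ?thesis by (simp add: f_def)
qed

theorem theorem2:
  fixes M :: "'w measure" and X :: "real \<Rightarrow> 'w \<Rightarrow> real ^ 'n"
    and \<psi> :: "real ^ 'n \<Rightarrow> real" and \<alpha> :: real
  assumes "isotropic_levy_process M X"
    and "levy_khintchine_exponent M X \<psi>"
    and "0 \<le> \<alpha>" and "\<alpha> < 2"
    and "regularly_varying_at_zero \<alpha> (radial_profile \<psi>)"
  shows "\<forall>\<epsilon>>0. \<exists>\<delta>>0. \<forall>t>0. \<forall>r. 0 < r \<longrightarrow> r \<le> \<delta> \<longrightarrow> t * radial_profile \<psi> r \<le> \<delta> \<longrightarrow>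
    \<bar>measure M {\<omega> \<in> space M. norm (X t \<omega>) \<ge> inverse r} / (t * radial_profile \<psi> r) -
      2 powr \<alpha> * Gamma ((real CARD('n) + \<alpha>) / 2) / (Gamma (real CARD('n) / 2) * Gamma (1 - \<alpha> / 2))\<bar> < \<epsilon>"
    (is "\<forall>\<epsilon>>0. \<exists>\<delta>>0. \<forall>t>0. \<forall>r. 0 < r \<longrightarrow> r \<le> \<delta> \<longrightarrow> t * ?f r \<le> \<delta> \<longrightarrow> \<bar>?Q t r - ?C\<bar> < \<epsilon>")
proof (rule ccontr)
  assume "\<not> ?thesis"
  then obtain \<epsilon> where \<epsilon>: "\<epsilon> > 0"
    and none: "\<not> (\<exists>\<delta>>0. \<forall>t>0. \<forall>r. 0 < r \<longrightarrow> r \<le> \<delta> \<longrightarrow> t * ?f r \<le> \<delta> \<longrightarrow> \<bar>?Q t r - ?C\<bar> < \<epsilon>)"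
    by blast
  have bad: "\<exists>t r. 0 < t \<and> 0 < r \<and> r \<le> \<delta> \<and> t * ?f r \<le> \<delta> \<and> \<epsilon> \<le> \<bar>?Q t r - ?C\<bar>"
    if "\<delta> > 0" for \<delta>
    using none that by (meson not_less)
  have L: "levy_process M X"
    using assms(1) by (simp add: isotropic_levy_process_def)
  \<comment> \<open>A failure of the joint limit gives points with \<open>r\<close> and \<open>t * \<psi> r\<close> tending to zero at which the
    quotient stays away from the limit. Below \<open>d\<close> the profile is positive.\<close>
  obtain d where d: "d > 0" "\<And>r. 0 < r \<Longrightarrow> r < d \<Longrightarrow> 0 < ?f r"
    using regularly_varying_at_zero_eventually_pos[OF assms(5)] unfolding eventually_at_right_field by auto
  define \<delta> where "\<delta> n = min (d / 2) (inverse (real (Suc n)))" for n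
  have \<delta>: "\<delta> n > 0" "\<delta> n < d" for n using d(1) by (auto simp: \<delta>_def)
  have \<delta>_lim: "\<delta> \<longlonglongrightarrow> 0"
  proof (rule tendsto_sandwich[OF _ _ tendsto_const LIMSEQ_inverse_real_of_nat])
    show "\<forall>\<^sub>F n in sequentially. 0 \<le> \<delta> n"
      using \<delta>(1) by (intro always_eventually allI less_imp_le)
    show "\<forall>\<^sub>F n in sequentially. \<delta> n \<le> inverse (real (Suc n))"
      by (intro always_eventually allI) (simp add: \<delta>_def)
  qed
  have "\<forall>n. \<exists>t r. 0 < t \<and> 0 < r \<and> r \<le> \<delta> n \<and> t * ?f r \<le> \<delta> n \<and> \<epsilon> \<le> \<bar>?Q t r - ?C\<bar>"
    by (intro allI bad \<delta>(1))
  then obtain t where "\<forall>n. \<exists>r. 0 < t n \<and> 0 < r \<and> r \<le> \<delta> n \<and> t n * ?f r \<le> \<delta> n \<and> \<epsilon> \<le> \<bar>?Q (t n) r - ?C\<bar>"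
    by (rule choice[THEN exE])
  then obtain r where all: "\<forall>n. 0 < t n \<and> 0 < r n \<and> r n \<le> \<delta> n \<and> t n * ?f (r n) \<le> \<delta> n
      \<and> \<epsilon> \<le> \<bar>?Q (t n) (r n) - ?C\<bar>"
    by (rule choice[THEN exE])
  have tr: "0 < t n" "0 < r n" "r n \<le> \<delta> n" "t n * ?f (r n) \<le> \<delta> n" "\<epsilon> \<le> \<bar>?Q (t n) (r n) - ?C\<bar>" for n
    using spec[OF all, of n] by blast+
  have f_pos: "0 < ?f (r n)" for n
    using d(2) tr(2,3)[of n] \<delta>(2)[of n] by simp
  have "r \<longlonglongrightarrow> 0"
    by (rule tendsto_sandwich[OF _ _ tendsto_const \<delta>_lim]) (use tr in \<open>auto intro!: always_eventually less_imp_le\<close>)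
  moreover have "(\<lambda>n. t n * ?f (r n)) \<longlonglongrightarrow> 0"
    by (rule tendsto_sandwich[OF _ _ tendsto_const \<delta>_lim]) (use tr f_pos in \<open>auto intro!: always_eventually less_imp_le\<close>)
  ultimately have "(\<lambda>n. ?Q (t n) (r n)) \<longlonglongrightarrow> ?C"
    by (intro tail_asymptotics_sequential[OF L assms(2-5)] tr f_pos)
  then have "\<forall>\<^sub>F n in sequentially. \<bar>?Q (t n) (r n) - ?C\<bar> < \<epsilon>"
    using \<epsilon> by (auto dest: tendstoD simp: dist_real_def)
  then obtain n where "\<bar>?Q (t n) (r n) - ?C\<bar> < \<epsilon>"
    by (auto dest: eventually_happens)
  then show False using tr(5)[of n] by simp
qed

end
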